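(* Let $P$ be a regular Schur labeled skew shape poset on $[n]$, i.e. $P\in\mathsf{RSP}_n$, and let $\lambda/\mu=\mathrm{sh}(\tau_P)$ be the shape of $\tau_P$. Then $$\Sigma_L(P) = [\mathsf{read}_{\tau_P}(T_{\lambda/\mu}),\ \mathsf{read}_{\tau_P}(T'_{\lambda/\mu})]_L .$$
   Context: Let $n$ be a nonnegative integer, $[n]=\{1,\dots,n\}$, and $\mathfrak S_n$ the symmetric group on $[n]$, with length function $\ell$ and simple transpositions $s_i=(i,i+1)$. The left weak Bruhat order $\preceq_L$ on $\mathfrak S_n$ is the partial order with covering relations $\sigma\prec s_i\sigma$ whenever $\ell(s_i\sigma)>\ell(\sigma)$. $[\sigma,\rho]_L=\{\gamma\mid\sigma\preceq_L\gamma\preceq_L\rho\}$. A skew partition $\lambda/\mu$ is a pair of partitions with $\mu_i\le\lambda_i$ for all $i$ (missing parts are $0$); its Young diagram is the set of boxes $(i,j)$ (row $i$ counted from the top, column $j$ from the left) with $\mu_i<j\le\lambda_i$; its size is $|\lambda|-|\mu|$. Every skew partition is assumed basic: its Young diagram has no empty rows and no empty columns. It is connected if for each pair of consecutive rows there are two boxes, one in each row, sharing an edge; in general the diagram splits into connected components, ordered from the top. A bijective tableau of shape $\lambda/\mu$ (of size $n$) is a filling of the Young diagram in which each element of $[n]$ appears exactly once; $T_B$ is the entry in box $B$ and $T^{-1}(k)$ is the box containing $k$. For a bijective tableau $\tau$, $\mathsf{poset}(\tau)$ is the poset on $[n]$ with $i\preceq_\tau j$ iff the box of $i$ is weakly above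 and weakly left of the box of $j$ in $\tau$. A Schur labeling is a bijective tableau whose rows decrease from left to right and whose columns increase from top to bottom. $\mathsf P_n$ is the set of posets with underlying set $[n]$. $\mathsf{SP}_n$ (Schur labeled skew shape posets) is the set of all $\mathsf{poset}(\tau)$ with $\tau$ a Schur labeling of some skew shape of size $n$. $P\in\mathsf P_n$ is regular if for all $x,y,z\in[n]$ with $x\preceq_P z$ and ($x<y<z$ or $z<y<x$), one has $x\preceq_P y$ or $y\preceq_P z$. $\mathsf{RSP}_n$ is the set of regular posets in $\mathsf{SP}_n$. For $P\in\mathsf{SP}_n$, $\tau_P$ is the unique Schur labeling $\tau$ of basic shape with $\mathsf{poset}(\tau)=P$ such that the minimum entry of the $i$th connected component of $\tau$ from the top is smaller than that of the $j$th component whenever $i<j$. $\Sigma_L(P)=\{\sigma\in\mathfrak S_n\mid \sigma(i)\le\sigma(j)\text{ for all } i\preceq_P j\}$. For bijective tableaux $\tau,T$ of the same shape, $\mathsf{read}_\tau(T)\in\mathfrak S_n$ is given by $\mathsf{read}_\tau(T)(k)=T_{\tau^{-1}(k)}$. $T_{\lambda/\mu}$ (resp. $T'_{\lambda/\mu}$) is the standard Young tableau of shape $\lambda/\mu$ obtained by filling in $1,2,\dots,n$ from left to right in each row, starting with the top row and proceeding downwards (resp. from top to bottom in each column, starting with the leftmost column and proceeding to the right). *)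

theory Defs
  imports "HOL-Combinatorics.Permutations" "HOL-Library.FuncSet"
begin

section \<open>The symmetric group and its left weak Bruhat order\<close>

text \<open>
  Elements of the symmetric group on \<open>{1..n}\<close> are the functions \<open>\<sigma>\<close> with
  \<open>\<sigma> permutes {1..n}\<close>; the product is composition of functions, so \<open>s_i \<circ> \<sigma>\<close> exchanges
  the values \<open>i\<close> and \<open>i + 1\<close> of \<open>\<sigma>\<close>.
\<close>

definition simple_transp :: "nat \<Rightarrow> nat \<Rightarrow> nat" where
  "simple_transp i = transpose i (i + 1)"

definition word_prod :: "nat list \<Rightarrow> nat \<Rightarrow> nat" where
  "word_prod w = foldr (\<lambda>i \<sigma>. simple_transp i \<circ> \<sigma>) w id"

definition coxeter_length :: "nat \<Rightarrow> (nat \<Rightarrow> nat) \<Rightarrow> nat" where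
  "coxeter_length n \<sigma> = (LEAST k. \<exists>w. length w = k \<and> set w \<subseteq> {1..<n} \<and> word_prod w = \<sigma>)"

definition left_weak_cover :: "nat \<Rightarrow> (nat \<Rightarrow> nat) \<Rightarrow> (nat \<Rightarrow> nat) \<Rightarrow> bool" where
  "left_weak_cover n \<sigma> \<rho> \<longleftrightarrow> \<sigma> permutes {1..n} \<and>
     (\<exists>i\<in>{1..<n}. \<rho> = simple_transp i \<circ> \<sigma> \<and> coxeter_length n \<rho> > coxeter_length n \<sigma>)"

definition left_weak_le :: "nat \<Rightarrow> (nat \<Rightarrow> nat) \<Rightarrow> (nat \<Rightarrow> nat) \<Rightarrow> bool" where
  "left_weak_le n = (left_weak_cover n)\<^sup>*\<^sup>*"

definition left_weak_interval :: "nat \<Rightarrow> (nat \<Rightarrow> nat) \<Rightarrow> (nat \<Rightarrow> nat) \<Rightarrow> (nat \<Rightarrow> nat) set" where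
  "left_weak_interval n \<sigma> \<rho> =
     {\<gamma>. \<gamma> permutes {1..n} \<and> left_weak_le n \<sigma> \<gamma> \<and> left_weak_le n \<gamma> \<rho>}"

section \<open>Skew partitions and their diagrams\<close>

definition is_partition :: "nat list \<Rightarrow> bool" where
  "is_partition l \<longleftrightarrow> sorted_wrt (\<ge>) l \<and> 0 \<notin> set l"

text \<open>Parts are indexed from 1; missing parts are 0.\<close>

definition part :: "nat list \<Rightarrow> nat \<Rightarrow> nat" where
  "part l i = (if 1 \<le> i \<and> i \<le> length l then l ! (i - 1) else 0)"

text \<open>A pair \<open>(\<lambda>, \<mu>)\<close> stands for the skew shape \<open>\<lambda>/\<mu>\<close>; a box is a pair (row, column).\<close>

type_synonym skew_shape = "nat list \<times> nat list"
type_synonym box = "nat \<times> nat"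

definition is_skew_partition :: "skew_shape \<Rightarrow> bool" where
  "is_skew_partition sh \<longleftrightarrow> is_partition (fst sh) \<and> is_partition (snd sh) \<and>
     (\<forall>i. part (snd sh) i \<le> part (fst sh) i)"

definition diagram :: "skew_shape \<Rightarrow> box set" where
  "diagram sh = {(i, j). i \<ge> 1 \<and> part (snd sh) i < j \<and> j \<le> part (fst sh) i}"

definition is_basic :: "skew_shape \<Rightarrow> bool" where
  "is_basic sh \<longleftrightarrow>
     (\<forall>i\<in>{1..length (fst sh)}. \<exists>j. (i, j) \<in> diagram sh) \<and>
     (\<forall>j\<in>{1..part (fst sh) 1}. \<exists>i. (i, j) \<in> diagram sh)"

definition is_basic_skew :: "skew_shape \<Rightarrow> bool" where
  "is_basic_skew sh \<longleftrightarrow> is_skew_partition sh \<and> is_basic sh"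

text \<open>
  A diagram is connected if any two consecutive rows contain boxes sharing an edge.
  So two boxes lie in the same connected component iff no two consecutive rows between
  their rows fail to do so.
\<close>

definition rows_linked :: "skew_shape \<Rightarrow> nat \<Rightarrow> bool" where
  "rows_linked sh r \<longleftrightarrow> (\<exists>j. (r, j) \<in> diagram sh \<and> (r + 1, j) \<in> diagram sh)"

definition component_rel :: "skew_shape \<Rightarrow> (box \<times> box) set" where
  "component_rel sh = {(b, c). b \<in> diagram sh \<and> c \<in> diagram sh \<and>
     (\<forall>r. min (fst b) (fst c) \<le> r \<and> r < max (fst b) (fst c) \<longrightarrow> rows_linked sh r)}"

definition components :: "skew_shape \<Rightarrow> box set set" where
  "components sh = diagram sh // component_rel sh"

definition is_above :: "box set \<Rightarrow> box set \<Rightarrow> bool" where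
  "is_above C C' \<longleftrightarrow> (\<forall>b\<in>C. \<forall>c\<in>C'. fst b < fst c)"

section \<open>Tableaux\<close>

text \<open>Fillings are made extensional so that equal tableaux are equal functions.\<close>

definition bijective_tableau :: "nat \<Rightarrow> skew_shape \<Rightarrow> (box \<Rightarrow> nat) \<Rightarrow> bool" where
  "bijective_tableau n sh T \<longleftrightarrow>
     T \<in> extensional (diagram sh) \<and> bij_betw T (diagram sh) {1..n}"

definition box_of :: "skew_shape \<Rightarrow> (box \<Rightarrow> nat) \<Rightarrow> nat \<Rightarrow> box" where
  "box_of sh T = the_inv_into (diagram sh) T"

definition tableau_poset :: "nat \<Rightarrow> skew_shape \<Rightarrow> (box \<Rightarrow> nat) \<Rightarrow> (nat \<times> nat) set" where
  "tableau_poset n sh \<tau> = {(i, j). i \<in> {1..n} \<and> j \<in> {1..n} \<and>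
     fst (box_of sh \<tau> i) \<le> fst (box_of sh \<tau> j) \<and>
     snd (box_of sh \<tau> i) \<le> snd (box_of sh \<tau> j)}"

definition schur_labeling :: "nat \<Rightarrow> skew_shape \<Rightarrow> (box \<Rightarrow> nat) \<Rightarrow> bool" where
  "schur_labeling n sh \<tau> \<longleftrightarrow> bijective_tableau n sh \<tau> \<and>
     (\<forall>i j j'. (i, j) \<in> diagram sh \<and> (i, j') \<in> diagram sh \<and> j < j' \<longrightarrow> \<tau> (i, j) > \<tau> (i, j')) \<and>
     (\<forall>i i' j. (i, j) \<in> diagram sh \<and> (i', j) \<in> diagram sh \<and> i < i' \<longrightarrow> \<tau> (i, j) < \<tau> (i', j))"

text \<open>The value outside \<open>{1..n}\<close> is the one required by \<open>permutes\<close>.\<close>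

definition read_tableau ::
    "nat \<Rightarrow> skew_shape \<Rightarrow> (box \<Rightarrow> nat) \<Rightarrow> (box \<Rightarrow> nat) \<Rightarrow> nat \<Rightarrow> nat" where
  "read_tableau n sh \<tau> T = (\<lambda>k. if k \<in> {1..n} then T (box_of sh \<tau> k) else k)"

text \<open>
  Filling in \<open>1, 2, \<dots>, n\<close> along a reading order of the boxes gives each box its rank in
  that order: rows from top to bottom, each read from left to right (\<open>row_tableau\<close>), or
  columns from left to right, each read from top to bottom (\<open>col_tableau\<close>).
\<close>

definition row_tableau :: "skew_shape \<Rightarrow> box \<Rightarrow> nat" where
  "row_tableau sh = restrict (\<lambda>(i, j).
     card {(i', j') \<in> diagram sh. i' < i \<or> (i' = i \<and> j' \<le> j)}) (diagram sh)"

definition col_tableau :: "skew_shape \<Rightarrow> box \<Rightarrow> nat" where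
  "col_tableau sh = restrict (\<lambda>(i, j).
     card {(i', j') \<in> diagram sh. j' < j \<or> (j' = j \<and> i' \<le> i)}) (diagram sh)"

section \<open>Regular Schur labeled skew shape posets\<close>

text \<open>
  A poset on \<open>{1..n}\<close> is the set of pairs \<open>(x, y)\<close> with \<open>x \<preceq> y\<close>, reflexive pairs included.
\<close>

definition SP :: "nat \<Rightarrow> (nat \<times> nat) set set" where
  "SP n = {tableau_poset n sh \<tau> | sh \<tau>. is_basic_skew sh \<and> schur_labeling n sh \<tau>}"

definition regular_poset :: "nat \<Rightarrow> (nat \<times> nat) set \<Rightarrow> bool" where
  "regular_poset n P \<longleftrightarrow> (\<forall>x\<in>{1..n}. \<forall>y\<in>{1..n}. \<forall>z\<in>{1..n}.
     (x, z) \<in> P \<and> (x < y \<and> y < z \<or> z < y \<and> y < x) \<longrightarrow> (x, y) \<in> P \<or> (y, z) \<in> P)"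

definition RSP :: "nat \<Rightarrow> (nat \<times> nat) set set" where
  "RSP n = {P \<in> SP n. regular_poset n P}"

definition is_canonical_labeling ::
    "nat \<Rightarrow> (nat \<times> nat) set \<Rightarrow> skew_shape \<Rightarrow> (box \<Rightarrow> nat) \<Rightarrow> bool" where
  "is_canonical_labeling n P sh \<tau> \<longleftrightarrow>
     is_basic_skew sh \<and> schur_labeling n sh \<tau> \<and> tableau_poset n sh \<tau> = P \<and>
     (\<forall>C\<in>components sh. \<forall>C'\<in>components sh. is_above C C' \<longrightarrow> Min (\<tau> ` C) < Min (\<tau> ` C'))"

text \<open>The labeling \<open>\<tau>_P\<close>, together with its shape.\<close>

definition canonical_labeling :: "nat \<Rightarrow> (nat \<times> nat) set \<Rightarrow> skew_shape \<times> (box \<Rightarrow> nat)" where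
  "canonical_labeling n P = (THE (sh, \<tau>). is_canonical_labeling n P sh \<tau>)"

definition Sigma_L :: "nat \<Rightarrow> (nat \<times> nat) set \<Rightarrow> (nat \<Rightarrow> nat) set" where
  "Sigma_L n P = {\<sigma>. \<sigma> permutes {1..n} \<and> (\<forall>(i, j)\<in>P. \<sigma> i \<le> \<sigma> j)}"

end

theory Submission
  imports Defs "HOL-Library.Product_Lexorder"
begin

text \<open>
  The left weak order compares permutations by inclusion of their inversion sets
  (\<open>left_weak_le_iff_inversions\<close>), so the theorem is a statement about pairs of labels \<open>x < y\<close>. Place
  the labels at the boxes of the canonical labeling \<open>\<tau>\<close>. The pair is an inversion of the row reading
  permutation iff \<open>y\<close> is read before \<open>x\<close> by rows, and an inversion of the column reading permutation
  iff \<open>y\<close> is read before \<open>x\<close> by columns. Two different boxes can be situated in two ways.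

  If one box is weakly north-west of the other, the poset compares the labels, and both readings
  visit the north-western box first. Hence \<open>(x, y)\<close> is an inversion of both reading permutations if
  \<open>y\<close> precedes \<open>x\<close> in the poset, and of neither if \<open>x\<close> precedes \<open>y\<close>. A permutation in the interval is
  thus forced to respect the poset.

  If one box is strictly north-east of the other, the poset leaves the labels incomparable, and a
  permutation that respects it may or may not invert them. Both cases have to be allowed by the
  interval: the pair must not be inverted by the row reading, but must be inverted by the column
  reading. Since rows visit the north-eastern box first and columns visit it last, this says that
  the north-eastern box carries the smaller label, which is \<open>north_east_less\<close>. Within one
  component it follows from rows decreasing and columns increasing. For different components
  regularity is used: no label outside a component can lie strictly between two labels of it
  (\<open>regular_connected_interval\<close>), so the label sets of the components do not interleave and are
  ordered like their minima. By the choice of \<open>\<tau>\<close> the upper component, which is the one further to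
  the north-east, has the smaller minimum.

  The labeling \<open>\<tau>\<close> is given by a definite description, and it has its defining property because such
  a labeling exists and is unique. It is unique because the poset, together with the order of the
  labels, determines which boxes are neighbours and in which direction, so that any two candidates
  differ by a translation on each component (\<open>connected_translation\<close>); the order of the components
  and the absence of empty rows and columns then fix all positions. It exists because the components
  of any Schur labeling can be moved past each other without affecting the poset
  (\<open>schur_coordinates_new\<close>). The boxes moved this way form a skew diagram again, as the
  finite convex sets of boxes without empty rows and columns are the basic skew diagrams
  (\<open>convex_set_is_basic_skew_diagram\<close>).
\<close>

section \<open>Inversions and the left weak order\<close>

text \<open>
  Inversions are recorded by positions, so that passing from \<open>\<sigma>\<close> to \<open>simple_transp i \<circ> \<sigma>\<close>, which
  exchanges two neighbouring values, adds or removes one single pair and leaves the others alone.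
\<close>

definition inversions :: "nat \<Rightarrow> (nat \<Rightarrow> nat) \<Rightarrow> (nat \<times> nat) set" where
  "inversions n \<sigma> = {(i, j). i \<in> {1..n} \<and> j \<in> {1..n} \<and> i < j \<and> \<sigma> j < \<sigma> i}"

lemma finite_inversions: "finite (inversions n \<sigma>)"
  by (rule finite_subset[of _ "{1..n} \<times> {1..n}"]) (auto simp: inversions_def)

lemma inversions_id: "inversions n id = {}"
  by (auto simp: inversions_def)

lemma simple_transp_permutes: "i \<in> {1..<n} \<Longrightarrow> simple_transp i permutes {1..n}"
  by (auto simp: simple_transp_def intro: permutes_swap_id)

lemma simple_transp_apply:
  "simple_transp i i = i + 1" "simple_transp i (i + 1) = i"
  by (simp_all add: simple_transp_def)

lemma simple_transp_involutive: "simple_transp i \<circ> simple_transp i = id"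
  by (simp add: simple_transp_def)

lemma inv_simple_transp: "inv (simple_transp i) = simple_transp i"
  by (simp add: simple_transp_def)

text \<open>
  Strict increase forces \<open>f i \<ge> i\<close> when started from the bottom and \<open>f i \<le> i\<close> when started from
  the top.
\<close>

lemma increasing_permutation_is_id:
  fixes f :: "nat \<Rightarrow> nat"
  assumes f: "f permutes {1..n}" and inc: "\<And>i. i \<in> {1..<n} \<Longrightarrow> f i < f (i + 1)"
  shows "f = id"
proof -
  have ge: "i \<le> f i" if "i \<in> {1..n}" for i
    using that
  proof (induction i)
    case (Suc i)
    then show ?case
      using inc[of i] permutes_in_image[OF f, of "Suc i"] by (cases "i = 0") force+
  qed simp
  have le: "f i \<le> i" if "i \<in> {1..n}" for i
    using that
  proof (induction "n - i" arbitrary: i)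
    case 0
    then show ?case using permutes_in_image[OF f, of i] by auto
  next
    case (Suc k)
    then have "f (i + 1) \<le> i + 1" by auto
    moreover have "f i < f (i + 1)" using inc[of i] Suc by auto
    ultimately show ?case by linarith
  qed
  show ?thesis
  proof
    fix i show "f i = id i"
      using ge[of i] le[of i] permutes_not_in[OF f, of i] by (cases "i \<in> {1..n}") auto
  qed
qed

text \<open>
  Exchanging the values \<open>i\<close> and \<open>i + 1\<close> alters the comparison of two values only when these are
  exactly \<open>i\<close> and \<open>i + 1\<close>; the one affected pair of positions is formed by their preimages.
\<close>

lemma inversions_simple_transp:
  assumes \<sigma>: "\<sigma> permutes {1..n}" and i: "i \<in> {1..<n}"
    and less: "inv \<sigma> i < inv \<sigma> (i + 1)"
  shows "inversions n (simple_transp i \<circ> \<sigma>) = insert (inv \<sigma> i, inv \<sigma> (i + 1)) (inversions n \<sigma>)"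
    and "(inv \<sigma> i, inv \<sigma> (i + 1)) \<notin> inversions n \<sigma>"
proof -
  have val: "\<sigma> (inv \<sigma> k) = k" for k using permutes_inverses(1)[OF \<sigma>] .
  have eq: "\<sigma> k = l \<longleftrightarrow> k = inv \<sigma> l" for k l using permutes_inverses[OF \<sigma>] by metis
  have in_n: "inv \<sigma> i \<in> {1..n}" "inv \<sigma> (i + 1) \<in> {1..n}"
    using i permutes_in_image[OF permutes_inv[OF \<sigma>]] by auto
  have cmp: "simple_transp i a < simple_transp i b \<longleftrightarrow>
      (if {a, b} = {i, i + 1} then b < a else a < b)" if "a \<noteq> b" for a b
    using that by (auto simp: simple_transp_def transpose_def doubleton_eq_iff)
  have inj: "\<sigma> k = \<sigma> l \<longleftrightarrow> k = l" for k l using permutes_inj[OF \<sigma>] by (auto dest: injD)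
  show "(inv \<sigma> i, inv \<sigma> (i + 1)) \<notin> inversions n \<sigma>"
    by (auto simp: inversions_def val)
  show "inversions n (simple_transp i \<circ> \<sigma>) = insert (inv \<sigma> i, inv \<sigma> (i + 1)) (inversions n \<sigma>)"
  proof (rule set_eqI)
    fix x :: "nat \<times> nat"
    obtain k l where x: "x = (k, l)" by (cases x)
    show "x \<in> inversions n (simple_transp i \<circ> \<sigma>) \<longleftrightarrow>
        x \<in> insert (inv \<sigma> i, inv \<sigma> (i + 1)) (inversions n \<sigma>)"
    proof (cases "{\<sigma> l, \<sigma> k} = {i, i + 1}")
      case True
      then consider "k = inv \<sigma> i" "l = inv \<sigma> (i + 1)" | "l = inv \<sigma> i" "k = inv \<sigma> (i + 1)"
        unfolding doubleton_eq_iff eq by blast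
      then show ?thesis
        using in_n less by cases (auto simp: x inversions_def val simple_transp_def)
    next
      case False
      then have "(k, l) \<noteq> (inv \<sigma> i, inv \<sigma> (i + 1))" by (auto simp: val)
      then show ?thesis using cmp[of "\<sigma> l" "\<sigma> k"] False
        by (cases "k = l") (auto simp: x inversions_def inj)
    qed
  qed
qed

lemma inversions_simple_transp_descent:
  assumes \<sigma>: "\<sigma> permutes {1..n}" and i: "i \<in> {1..<n}"
    and less: "inv \<sigma> (i + 1) < inv \<sigma> i"
  shows "card (inversions n \<sigma>) = card (inversions n (simple_transp i \<circ> \<sigma>)) + 1"
proof -
  let ?s = "simple_transp i" and ?\<rho> = "simple_transp i \<circ> \<sigma>"
  have \<rho>: "?\<rho> permutes {1..n}"
    using permutes_compose[OF \<sigma> simple_transp_permutes[OF i]] .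
  have "inv ?\<rho> = inv \<sigma> \<circ> ?s"
    using o_inv_distrib[OF permutes_bij[OF simple_transp_permutes[OF i]] permutes_bij[OF \<sigma>]]
    by (simp only: inv_simple_transp)
  with less have l: "inv ?\<rho> i < inv ?\<rho> (i + 1)"
    by (simp only: comp_apply simple_transp_apply)
  have undo: "?s \<circ> ?\<rho> = \<sigma>"
    by (simp only: comp_assoc[symmetric] simple_transp_involutive id_comp)
  show ?thesis
    using card_insert_disjoint[OF finite_inversions inversions_simple_transp(2)[OF \<rho> i l]]
    unfolding inversions_simple_transp(1)[OF \<rho> i l, symmetric] undo by simp
qed

text \<open>
  If no ascent of \<open>\<sigma>\<close> could be turned into an inversion of \<open>\<rho>\<close>, then \<open>\<rho> \<circ> inv \<sigma>\<close> would increase on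
  every pair of neighbours: at an ascent of \<open>\<sigma>\<close> because the pair is no inversion of \<open>\<rho>\<close>, at a
  descent because inversions of \<open>\<sigma>\<close> are inversions of \<open>\<rho>\<close>. It would then be the identity.
\<close>

lemma exists_ascent_towards:
  assumes \<sigma>: "\<sigma> permutes {1..n}" and \<rho>: "\<rho> permutes {1..n}"
    and sub: "inversions n \<sigma> \<subseteq> inversions n \<rho>" and ne: "\<sigma> \<noteq> \<rho>"
  obtains i where "i \<in> {1..<n}" "inv \<sigma> i < inv \<sigma> (i + 1)"
    "(inv \<sigma> i, inv \<sigma> (i + 1)) \<in> inversions n \<rho>"
proof (rule ccontr)
  assume no: "\<not> thesis"
  have "\<rho> \<circ> inv \<sigma> = id"
  proof (rule increasing_permutation_is_id)
    show "\<rho> \<circ> inv \<sigma> permutes {1..n}"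
      using permutes_compose[OF permutes_inv[OF \<sigma>] \<rho>] .
    fix i assume i: "i \<in> {1..<n}"
    let ?p = "inv \<sigma> i" and ?q = "inv \<sigma> (i + 1)"
    have pq: "?p \<in> {1..n}" "?q \<in> {1..n}"
      using i permutes_in_image[OF permutes_inv[OF \<sigma>]] by auto
    have ne: "?p \<noteq> ?q" using permutes_inverses(1)[OF \<sigma>] by (metis n_not_Suc_n Suc_eq_plus1)
    then have ne': "\<rho> ?p \<noteq> \<rho> ?q" using permutes_inj[OF \<rho>] by (auto dest: injD)
    show "(\<rho> \<circ> inv \<sigma>) i < (\<rho> \<circ> inv \<sigma>) (i + 1)"
    proof (cases "?p < ?q")
      case True
      then have "(?p, ?q) \<notin> inversions n \<rho>" using no that[OF i True] by blast
      then show ?thesis using True pq ne' by (auto simp: inversions_def)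
    next
      case False
      then have "(?q, ?p) \<in> inversions n \<sigma>"
        using pq ne by (auto simp: inversions_def permutes_inverses(1)[OF \<sigma>])
      with sub have "(?q, ?p) \<in> inversions n \<rho>" by blast
      then show ?thesis by (auto simp: inversions_def)
    qed
  qed
  then have "\<rho> = \<sigma>"
    using permutes_inverses(2)[OF \<sigma>] by (metis comp_apply eq_id_iff ext)
  with ne show False by simp
qed

text \<open>
  One step of the climb from \<open>\<sigma>\<close> to \<open>\<rho>\<close>; the cardinality shows that the climb ends.
\<close>

lemma ascent_towards:
  assumes \<sigma>: "\<sigma> permutes {1..n}" and \<rho>: "\<rho> permutes {1..n}"
    and sub: "inversions n \<sigma> \<subseteq> inversions n \<rho>" and ne: "\<sigma> \<noteq> \<rho>"
  obtains i where "i \<in> {1..<n}" "inv \<sigma> i < inv \<sigma> (i + 1)"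
    "simple_transp i \<circ> \<sigma> permutes {1..n}"
    "inversions n (simple_transp i \<circ> \<sigma>) \<subseteq> inversions n \<rho>"
    "card (inversions n \<rho> - inversions n \<sigma>)
      = Suc (card (inversions n \<rho> - inversions n (simple_transp i \<circ> \<sigma>)))"
proof -
  from exists_ascent_towards[OF assms] obtain i where i: "i \<in> {1..<n}"
    "inv \<sigma> i < inv \<sigma> (i + 1)" "(inv \<sigma> i, inv \<sigma> (i + 1)) \<in> inversions n \<rho>" .
  let ?e = "(inv \<sigma> i, inv \<sigma> (i + 1))" and ?\<sigma> = "simple_transp i \<circ> \<sigma>"
  note step = inversions_simple_transp[OF \<sigma> i(1,2)]
  let ?A = "inversions n \<rho> - inversions n ?\<sigma>"
  have eq: "inversions n \<rho> - inversions n \<sigma> = insert ?e ?A"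
    unfolding step(1) using step(2) i(3) by blast
  have "?e \<notin> ?A" "finite ?A"
    unfolding step(1) using finite_inversions by blast+
  then have "card (inversions n \<rho> - inversions n \<sigma>) = Suc (card ?A)"
    unfolding eq by (rule card_insert_disjoint[rotated])
  moreover have "inversions n ?\<sigma> \<subseteq> inversions n \<rho>"
    unfolding step(1) using i(3) sub by blast
  moreover have "?\<sigma> permutes {1..n}"
    using permutes_compose[OF \<sigma> simple_transp_permutes[OF i(1)]] .
  ultimately show thesis using that i by blast
qed

lemma word_prod_snoc: "word_prod (w @ [i]) = word_prod w \<circ> simple_transp i"
  by (induction w) (auto simp: word_prod_def comp_assoc)

lemma word_prod_permutes: "set w \<subseteq> {1..<n} \<Longrightarrow> word_prod w permutes {1..n}"
proof (induction w)
  case Nil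
  show ?case using permutes_id unfolding id_def by (simp add: word_prod_def)
next
  case (Cons i w)
  then show ?case using permutes_compose[of "word_prod w" "{1..n}" "simple_transp i"]
      simple_transp_permutes[of i n] by (simp add: word_prod_def comp_def)
qed

text \<open>
  With \<open>\<sigma> = id\<close> this writes every permutation as a word whose length is its number of inversions.
\<close>

lemma word_between:
  assumes "\<sigma> permutes {1..n}" and "\<rho> permutes {1..n}"
    and "inversions n \<sigma> \<subseteq> inversions n \<rho>"
  shows "\<exists>w. set w \<subseteq> {1..<n} \<and> length w = card (inversions n \<rho> - inversions n \<sigma>)
           \<and> word_prod w \<circ> \<sigma> = \<rho>"
  using assms
proof (induction "card (inversions n \<rho> - inversions n \<sigma>)" arbitrary: \<sigma> rule: less_induct)
  case less
  show ?case
  proof (cases "\<sigma> = \<rho>")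
    case True
    then show ?thesis by (intro exI[of _ "[]"]) (simp add: word_prod_def)
  next
    case False
    from ascent_towards[OF less.prems False] obtain i where i: "i \<in> {1..<n}"
      "simple_transp i \<circ> \<sigma> permutes {1..n}"
      "inversions n (simple_transp i \<circ> \<sigma>) \<subseteq> inversions n \<rho>"
      "card (inversions n \<rho> - inversions n \<sigma>)
        = Suc (card (inversions n \<rho> - inversions n (simple_transp i \<circ> \<sigma>)))" by metis
    from less.hyps[OF _ i(2) less.prems(2) i(3)] i(4)
    obtain w where "set w \<subseteq> {1..<n}"
      "length w = card (inversions n \<rho> - inversions n (simple_transp i \<circ> \<sigma>))"
      "word_prod w \<circ> (simple_transp i \<circ> \<sigma>) = \<rho>" by auto
    then show ?thesis using i(1,4)
      by (intro exI[of _ "w @ [i]"]) (simp add: word_prod_snoc comp_assoc)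
  qed
qed

lemma card_inversions_word_prod:
  "set w \<subseteq> {1..<n} \<Longrightarrow> card (inversions n (word_prod w)) \<le> length w"
proof (induction w)
  case Nil
  show ?case using inversions_id unfolding id_def by (simp add: word_prod_def)
next
  case (Cons i w)
  let ?\<sigma> = "word_prod w"
  have i: "i \<in> {1..<n}" and \<sigma>: "?\<sigma> permutes {1..n}"
    using Cons.prems word_prod_permutes by auto
  have "inv ?\<sigma> i \<noteq> inv ?\<sigma> (i + 1)"
    using permutes_inverses(1)[OF \<sigma>] by (metis n_not_Suc_n Suc_eq_plus1)
  then consider "inv ?\<sigma> i < inv ?\<sigma> (i + 1)" | "inv ?\<sigma> (i + 1) < inv ?\<sigma> i" by linarith
  then have "card (inversions n (simple_transp i \<circ> ?\<sigma>)) \<le> Suc (card (inversions n ?\<sigma>))"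
  proof cases
    case 1
    note step = inversions_simple_transp[OF \<sigma> i 1]
    show ?thesis unfolding step(1) card_insert_disjoint[OF finite_inversions step(2)] by simp
  next
    case 2
    show ?thesis unfolding inversions_simple_transp_descent[OF \<sigma> i 2] by simp
  qed
  moreover have "word_prod (i # w) = simple_transp i \<circ> ?\<sigma>" by (simp add: word_prod_def)
  moreover have "card (inversions n ?\<sigma>) \<le> length w" using Cons by simp
  ultimately show ?case by (simp del: o_apply)
qed

lemma coxeter_length_eq_card_inversions:
  assumes "\<sigma> permutes {1..n}"
  shows "coxeter_length n \<sigma> = card (inversions n \<sigma>)"
  unfolding coxeter_length_def
proof (rule Least_equality)
  show "\<exists>w. length w = card (inversions n \<sigma>) \<and> set w \<subseteq> {1..<n} \<and> word_prod w = \<sigma>"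
    using word_between[OF permutes_id assms] by (auto simp: inversions_id)
next
  fix k assume "\<exists>w. length w = k \<and> set w \<subseteq> {1..<n} \<and> word_prod w = \<sigma>"
  then show "card (inversions n \<sigma>) \<le> k" using card_inversions_word_prod by auto
qed

lemma left_weak_cover_iff:
  "left_weak_cover n \<sigma> \<rho> \<longleftrightarrow> \<sigma> permutes {1..n} \<and>
     (\<exists>i\<in>{1..<n}. \<rho> = simple_transp i \<circ> \<sigma> \<and> inv \<sigma> i < inv \<sigma> (i + 1))"
proof -
  have "coxeter_length n (simple_transp i \<circ> \<sigma>) > coxeter_length n \<sigma>
      \<longleftrightarrow> inv \<sigma> i < inv \<sigma> (i + 1)"
    if \<sigma>: "\<sigma> permutes {1..n}" and i: "i \<in> {1..<n}" for i
  proof -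
    have "simple_transp i \<circ> \<sigma> permutes {1..n}"
      using permutes_compose[OF \<sigma> simple_transp_permutes[OF i]] .
    note len = coxeter_length_eq_card_inversions[OF this]
      coxeter_length_eq_card_inversions[OF \<sigma>]
    have "inv \<sigma> i \<noteq> inv \<sigma> (i + 1)"
      using permutes_inverses(1)[OF \<sigma>] by (metis n_not_Suc_n Suc_eq_plus1)
    then consider "inv \<sigma> i < inv \<sigma> (i + 1)" | "inv \<sigma> (i + 1) < inv \<sigma> i" by linarith
    then show ?thesis
    proof cases
      case 1
      note step = inversions_simple_transp[OF \<sigma> i 1]
      show ?thesis unfolding len step(1) card_insert_disjoint[OF finite_inversions step(2)]
        using 1 by simp
    next
      case 2
      then show ?thesis unfolding len inversions_simple_transp_descent[OF \<sigma> i 2] by simp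
    qed
  qed
  then show ?thesis unfolding left_weak_cover_def by blast
qed

text \<open>
  A cover enlarges the inversion set, so the order implies inclusion. Conversely, inclusion lets one
  climb by \<open>ascent_towards\<close> without ever leaving the inversions of \<open>\<rho>\<close>.
\<close>

lemma left_weak_le_iff_inversions:
  assumes \<sigma>: "\<sigma> permutes {1..n}" and \<rho>: "\<rho> permutes {1..n}"
  shows "left_weak_le n \<sigma> \<rho> \<longleftrightarrow> inversions n \<sigma> \<subseteq> inversions n \<rho>"
proof
  assume "left_weak_le n \<sigma> \<rho>"
  then show "inversions n \<sigma> \<subseteq> inversions n \<rho>"
    unfolding left_weak_le_def
  proof (induction rule: rtranclp_induct)
    case (step \<alpha> \<beta>)
    then show ?case using inversions_simple_transp(1) by (auto simp: left_weak_cover_iff)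
  qed simp
next
  assume "inversions n \<sigma> \<subseteq> inversions n \<rho>"
  then show "left_weak_le n \<sigma> \<rho>"
    using \<sigma> 
  proof (induction "card (inversions n \<rho> - inversions n \<sigma>)" arbitrary: \<sigma> rule: less_induct)
    case less
    show ?case
    proof (cases "\<sigma> = \<rho>")
      case True
      then show ?thesis by (simp add: left_weak_le_def)
    next
      case False
      from ascent_towards[OF less.prems(2) \<rho> less.prems(1) False] obtain i
        where i: "i \<in> {1..<n}" "inv \<sigma> i < inv \<sigma> (i + 1)"
          "simple_transp i \<circ> \<sigma> permutes {1..n}"
          "inversions n (simple_transp i \<circ> \<sigma>) \<subseteq> inversions n \<rho>"
          "card (inversions n \<rho> - inversions n \<sigma>)
            = Suc (card (inversions n \<rho> - inversions n (simple_transp i \<circ> \<sigma>)))" .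
      have "left_weak_le n (simple_transp i \<circ> \<sigma>) \<rho>"
        using less.hyps[OF _ i(4,3)] i(5) by simp
      moreover have "left_weak_cover n \<sigma> (simple_transp i \<circ> \<sigma>)"
        using less.prems(2) i(1,2) by (auto simp: left_weak_cover_iff)
      ultimately show ?thesis
        unfolding left_weak_le_def by (meson converse_rtranclp_into_rtranclp)
    qed
  qed
qed

section \<open>Ranks in finite linear orders\<close>

text \<open>
  Ranks serve twice: the two reading tableaux are ranks in the lexicographic order on boxes (with
  coordinates swapped for reading by columns), and the canonical labeling is obtained by ranking
  pairs lexicographically. The order on pairs is lexicographic throughout.
\<close>

definition rank :: "'a::linorder set \<Rightarrow> 'a \<Rightarrow> nat" where
  "rank A a = card {b \<in> A. b \<le> a}"

lemma rank_le_iff: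
  assumes "finite A" "a \<in> A" "b \<in> A"
  shows "rank A a \<le> rank A b \<longleftrightarrow> a \<le> b"
proof
  assume "a \<le> b"
  then show "rank A a \<le> rank A b"
    unfolding rank_def using assms by (intro card_mono) auto
next
  show "a \<le> b" if "rank A a \<le> rank A b"
  proof (rule ccontr)
    assume "\<not> a \<le> b"
    then have "{c \<in> A. c \<le> b} \<subset> {c \<in> A. c \<le> a}" using assms by auto
    then have "rank A b < rank A a"
      unfolding rank_def using assms by (intro psubset_card_mono) auto
    with that show False by simp
  qed
qed

lemma rank_less_iff:
  assumes "finite A" "a \<in> A" "b \<in> A"
  shows "rank A a < rank A b \<longleftrightarrow> a < b"
  using rank_le_iff[OF assms(1,3,2)] by auto

lemma bij_betw_rank:
  assumes "finite A"
  shows "bij_betw (rank A) A {1..card A}"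
proof -
  have inj: "inj_on (rank A) A"
    using rank_le_iff[OF assms] by (intro inj_onI) (metis order_antisym order_refl)
  have "rank A ` A \<subseteq> {1..card A}"
  proof
    fix k assume "k \<in> rank A ` A"
    then obtain a where a: "a \<in> A" "k = rank A a" by blast
    then have "a \<in> {b \<in> A. b \<le> a}" by simp
    then have "0 < k" unfolding a(2) rank_def using assms by (auto simp: card_gt_0_iff)
    moreover have "k \<le> card A" unfolding a(2) rank_def using assms by (auto intro: card_mono)
    ultimately show "k \<in> {1..card A}" by simp
  qed
  moreover have "card (rank A ` A) = card {1..card A}" using card_image[OF inj] by simp
  ultimately have "rank A ` A = {1..card A}" by (intro card_subset_eq) auto
  with inj show ?thesis by (simp add: bij_betw_def)
qed

lemma rank_atLeastAtMost_1: "k \<le> m \<Longrightarrow> rank {1..m} k = (k::nat)"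
proof -
  assume "k \<le> m"
  then have "{b \<in> {1..m}. b \<le> k} = {1..k}" by auto
  then show ?thesis by (simp add: rank_def)
qed

lemma card_image_cong_fibres:
  assumes fib: "\<And>x y. x \<in> S \<Longrightarrow> y \<in> S \<Longrightarrow> f x = f y \<longleftrightarrow> g x = g y"
  shows "card (f ` S) = card (g ` S)"
proof -
  \<comment> \<open>any representative of a fibre of \<open>f\<close> yields the value of \<open>g\<close> on that fibre\<close>
  let ?h = "\<lambda>b. g (inv_into S f b)"
  have h: "?h (f x) = g x" if "x \<in> S" for x
    using fib[OF inv_into_into[of "f x" f S] that] that f_inv_into_f[of "f x" f S] by auto
  have "g ` S = ?h ` (f ` S)" using h by (simp add: image_image)
  moreover have "inj_on ?h (f ` S)" using h fib by (auto simp: inj_on_def)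
  ultimately show ?thesis by (simp add: card_image)
qed

text \<open>
  A coordinate that takes all values in an initial segment of the positive integers equals the number of values up to
  it, and this number depends only on how the coordinate compares points.
\<close>

lemma gapless_coordinates_unique:
  fixes f g :: "'a \<Rightarrow> nat"
  assumes f: "f ` N = {1..m}" and g: "g ` N = {1..m'}"
    and le: "\<And>x y. x \<in> N \<Longrightarrow> y \<in> N \<Longrightarrow> f x \<le> f y \<longleftrightarrow> g x \<le> g y"
    and x: "x \<in> N"
  shows "f x = g x"
proof -
  let ?S = "{y \<in> N. f y \<le> f x}"
  have S: "?S = {y \<in> N. g y \<le> g x}" using le x by blast
  have "card (f ` ?S) = card (g ` ?S)"
    using le by (intro card_image_cong_fibres) (auto simp: order_eq_iff)
  moreover have "f ` ?S = {b \<in> {1..m}. b \<le> f x}" unfolding f[symmetric] by auto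
  moreover have "g ` ?S = {b \<in> {1..m'}. b \<le> g x}" unfolding S g[symmetric] by auto
  ultimately have "rank {1..m} (f x) = rank {1..m'} (g x)" by (simp add: rank_def)
  moreover have "f x \<in> {1..m}" "g x \<in> {1..m'}" using f g x by blast+
  ultimately show ?thesis using rank_atLeastAtMost_1[of "f x" m] rank_atLeastAtMost_1[of "g x" m']
    by simp
qed

section \<open>Coordinates of Schur labelings\<close>

text \<open>
  A Schur labeling is studied through the functions that send a label to the row and the column of
  its box. Skew diagrams enter only as order-convex sets of boxes, since this description is
  symmetric in rows and columns and survives a rearrangement of the components. Being basic means
  that each of the two coordinates takes precisely the values \<open>1, \<dots>, m\<close> for some \<open>m\<close>.
\<close>

locale schur_coordinates =
  fixes n :: nat and r c :: "nat \<Rightarrow> nat" and P :: "(nat \<times> nat) set"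
  assumes coordinates_inj:
      "\<And>x y. x \<in> {1..n} \<Longrightarrow> y \<in> {1..n} \<Longrightarrow> r x = r y \<Longrightarrow> c x = c y \<Longrightarrow> x = y"
    and convex: "\<And>x y a b. x \<in> {1..n} \<Longrightarrow> y \<in> {1..n} \<Longrightarrow> r x \<le> a \<Longrightarrow> a \<le> r y \<Longrightarrow>
        c x \<le> b \<Longrightarrow> b \<le> c y \<Longrightarrow> \<exists>z\<in>{1..n}. r z = a \<and> c z = b"
    and row_decreasing:
      "\<And>x y. x \<in> {1..n} \<Longrightarrow> y \<in> {1..n} \<Longrightarrow> r x = r y \<Longrightarrow> c x < c y \<Longrightarrow> y < x"
    and column_increasing:
      "\<And>x y. x \<in> {1..n} \<Longrightarrow> y \<in> {1..n} \<Longrightarrow> c x = c y \<Longrightarrow> r x < r y \<Longrightarrow> x < y"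
    and rows_gapless: "\<exists>m. r ` {1..n} = {1..m}"
    and columns_gapless: "\<exists>m. c ` {1..n} = {1..m}"
    and poset_iff:
      "\<And>x y. (x, y) \<in> P \<longleftrightarrow> x \<in> {1..n} \<and> y \<in> {1..n} \<and> r x \<le> r y \<and> c x \<le> c y"

definition connected :: "('a \<times> 'a) set \<Rightarrow> ('a \<times> 'a) set" where
  "connected P = (P \<union> P\<inverse>)\<^sup>*"

definition leader :: "(nat \<times> nat) set \<Rightarrow> nat \<Rightarrow> nat" where
  "leader P x = Min (connected P `` {x})"

text \<open>
  Distinct components are ordered from the top by their smallest labels. Boxes of different
  components never share a row, so it suffices to compare rows.
\<close>

definition canonical_coordinates ::
    "nat \<Rightarrow> (nat \<Rightarrow> nat) \<Rightarrow> (nat \<times> nat) set \<Rightarrow> bool" where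
  "canonical_coordinates n r P \<longleftrightarrow> (\<forall>x\<in>{1..n}. \<forall>y\<in>{1..n}.
     (x, y) \<notin> connected P \<longrightarrow> r x < r y \<longrightarrow> leader P x < leader P y)"

definition rows_joined :: "nat \<Rightarrow> (nat \<Rightarrow> nat) \<Rightarrow> (nat \<Rightarrow> nat) \<Rightarrow> nat \<Rightarrow> bool" where
  "rows_joined n r c a \<longleftrightarrow> (\<exists>x\<in>{1..n}. \<exists>y\<in>{1..n}. r x = a \<and> r y = a + 1 \<and> c x = c y)"

lemma connected_refl [simp]: "(x, x) \<in> connected P"
  by (simp add: connected_def)

lemma connected_trans: "(x, y) \<in> connected P \<Longrightarrow> (y, z) \<in> connected P \<Longrightarrow> (x, z) \<in> connected P"
  by (simp add: connected_def)

lemma connected_sym: "(x, y) \<in> connected P \<Longrightarrow> (y, x) \<in> connected P"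
  unfolding connected_def by (rule symD[OF sym_rtrancl[OF sym_Un_converse]])

lemma connected_base: "(x, y) \<in> P \<Longrightarrow> (x, y) \<in> connected P"
  by (simp add: connected_def r_into_rtrancl)

lemma leader_cong: "(x, y) \<in> connected P \<Longrightarrow> leader P x = leader P y"
  unfolding leader_def by (rule arg_cong[where f = Min]) (auto intro: connected_trans connected_sym)

context schur_coordinates
begin

lemma poset_in: "(x, y) \<in> P \<Longrightarrow> x \<in> {1..n} \<and> y \<in> {1..n}"
  by (simp add: poset_iff)

lemma connected_in: "(x, y) \<in> connected P \<Longrightarrow> x \<in> {1..n} \<Longrightarrow> y \<in> {1..n}"
  unfolding connected_def by (induction rule: rtrancl_induct) (auto dest: poset_in)

lemma finite_connected_class: "x \<in> {1..n} \<Longrightarrow> finite (connected P `` {x})"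
  by (rule finite_subset[of _ "{1..n}"]) (use connected_in in blast, simp)

lemma leader_connected: "x \<in> {1..n} \<Longrightarrow> (x, leader P x) \<in> connected P"
  using Min_in[OF finite_connected_class, of x] connected_refl[of x P]
  unfolding leader_def by (metis Image_singleton_iff empty_iff)

lemma leader_le: "x \<in> {1..n} \<Longrightarrow> (x, y) \<in> connected P \<Longrightarrow> leader P x \<le> y"
  using Min_le[OF finite_connected_class, of x y] unfolding leader_def by blast

lemma leader_in: "x \<in> {1..n} \<Longrightarrow> leader P x \<in> {1..n}"
  using leader_connected connected_in by blast

lemma leader_eq_iff:
  "x \<in> {1..n} \<Longrightarrow> y \<in> {1..n} \<Longrightarrow> leader P x = leader P y \<longleftrightarrow> (x, y) \<in> connected P"
proof
  assume xy: "x \<in> {1..n}" "y \<in> {1..n}" and "leader P x = leader P y"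
  then have "(x, leader P x) \<in> connected P" "(leader P x, y) \<in> connected P"
    using leader_connected[of x] connected_sym[OF leader_connected[of y]] by simp_all
  then show "(x, y) \<in> connected P" by (rule connected_trans)
qed (rule leader_cong)

text \<open>
  Labels in different components are incomparable, hence their boxes lie strictly to the north-east
  and south-west of each other. In particular the order of the columns is opposite to that of the
  rows.
\<close>

lemma incomparable:
  assumes "x \<in> {1..n}" "y \<in> {1..n}" "(x, y) \<notin> connected P"
  shows "r x < r y \<and> c y < c x \<or> r y < r x \<and> c x < c y"
proof -
  have "(x, y) \<notin> P" "(y, x) \<notin> P"
    using assms(3) connected_base[of x y P] connected_sym[OF connected_base[of y x P]] by auto
  then have "\<not> (r x \<le> r y \<and> c x \<le> c y)" "\<not> (r y \<le> r x \<and> c y \<le> c x)"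
    using assms(1,2) by (simp_all add: poset_iff)
  then show ?thesis by linarith
qed

lemma poset_imp_rows_joined:
  assumes "(x, y) \<in> P" "r x \<le> a" "a < r y"
  shows "rows_joined n r c a"
proof -
  obtain u v where "u \<in> {1..n}" "r u = a" "c u = c x" "v \<in> {1..n}" "r v = a + 1" "c v = c x"
    using convex[of x y a "c x"] convex[of x y "a + 1" "c x"] assms by (auto simp: poset_iff)
  then show ?thesis unfolding rows_joined_def by fastforce
qed

lemma connected_imp_rows_joined:
  assumes "(x, y) \<in> connected P" "min (r x) (r y) \<le> a" "a < max (r x) (r y)"
  shows "rows_joined n r c a"
  using assms unfolding connected_def
proof (induction arbitrary: a rule: rtrancl_induct)
  case (step y z)
  consider "min (r x) (r y) \<le> a" "a < max (r x) (r y)" | "r y \<le> a" "a < r z" | "r z \<le> a" "a < r y"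
    using step.prems by linarith
  then show ?case
  proof cases
    case 2
    then show ?thesis using step.hyps(2) poset_imp_rows_joined by (auto simp: poset_iff)
  next
    case 3
    then show ?thesis using step.hyps(2) poset_imp_rows_joined by (auto simp: poset_iff)
  qed (rule step.IH)
qed simp

lemma rows_joined_imp_connected_aux:
  assumes "x \<in> {1..n}" "y \<in> {1..n}" "r x \<le> r y"
    and "\<And>a. r x \<le> a \<Longrightarrow> a < r y \<Longrightarrow> rows_joined n r c a"
  shows "(x, y) \<in> connected P"
  using assms
proof (induction "r y - r x" arbitrary: y)
  case 0
  then have "(x, y) \<in> P \<or> (y, x) \<in> P" by (auto simp: poset_iff)
  then show ?case using connected_base connected_sym by metis
next
  case (Suc k)
  then have "rows_joined n r c (r y - 1)" by simp
  then obtain u v where uv: "u \<in> {1..n}" "v \<in> {1..n}" "r u = r y - 1" "r v = r y" "c u = c v"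
    using Suc.hyps(2) unfolding rows_joined_def by auto
  have "(x, u) \<in> connected P"
    using Suc.hyps(2) uv by (intro Suc.hyps(1) Suc.prems) auto
  moreover have "(u, v) \<in> connected P" using uv by (intro connected_base) (simp add: poset_iff)
  moreover have "(v, y) \<in> P \<or> (y, v) \<in> P" using uv Suc.prems by (auto simp: poset_iff)
  then have "(v, y) \<in> connected P" using connected_base connected_sym by metis
  ultimately show ?case using connected_trans by metis
qed

text \<open>
  Comparable boxes span a rectangle inside the diagram, which joins all rows that it meets; in the
  other direction one descends row by row through shared columns. So the geometric components are
  those of the comparability graph.
\<close>

lemma connected_iff_rows_joined:
  assumes "x \<in> {1..n}" "y \<in> {1..n}"
  shows "(x, y) \<in> connected P \<longleftrightarrow>
    (\<forall>a. min (r x) (r y) \<le> a \<and> a < max (r x) (r y) \<longrightarrow> rows_joined n r c a)"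
proof
  assume *: "\<forall>a. min (r x) (r y) \<le> a \<and> a < max (r x) (r y) \<longrightarrow> rows_joined n r c a"
  show "(x, y) \<in> connected P"
  proof (cases "r x \<le> r y")
    case True
    then show ?thesis using rows_joined_imp_connected_aux[OF assms] * by auto
  next
    case False
    then have "(y, x) \<in> connected P" using rows_joined_imp_connected_aux[of y x] assms * by auto
    then show ?thesis by (rule connected_sym)
  qed
qed (use connected_imp_rows_joined in blast)

text \<open>
  Between two boxes of different components some row is not joined to the next one, and no component
  can cross that gap.
\<close>

lemma connected_classes_row_separated:
  assumes xy: "x \<in> {1..n}" "y \<in> {1..n}" "(x, y) \<notin> connected P" "r x < r y"
    and x': "(x, x') \<in> connected P" and y': "(y, y') \<in> connected P"
  shows "r x' < r y'"
proof -
  \<comment> \<open>a gap between the two components\<close>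
  obtain a where a: "r x \<le> a" "a < r y" "\<not> rows_joined n r c a"
    using connected_iff_rows_joined[OF xy(1,2)] xy(3,4) by auto
  have "r x' \<le> a" using connected_imp_rows_joined[OF x', of a] a by linarith
  moreover have "a < r y'" using connected_imp_rows_joined[OF y', of a] a by linarith
  ultimately show ?thesis by simp
qed

subsection \<open>Covers\<close>

text \<open>
  By convexity, a box weakly to the south-east of a different one is reached through a right or lower
  neighbour of the latter that still lies in the diagram.
\<close>

lemma cover_iff_adjacent:
  assumes "x \<in> {1..n}" "y \<in> {1..n}"
  shows "(x, y) \<in> P \<and> x \<noteq> y \<and> (\<forall>z. (x, z) \<in> P \<and> (z, y) \<in> P \<longrightarrow> z = x \<or> z = y) \<longleftrightarrow>
    r y = r x \<and> c y = c x + 1 \<or> r y = r x + 1 \<and> c y = c x" (is "?cov \<longleftrightarrow> ?adj")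
proof
  assume adj: ?adj
  have "z = x \<or> z = y" if "(x, z) \<in> P" "(z, y) \<in> P" for z
  proof -
    have z: "z \<in> {1..n}" "r x \<le> r z" "r z \<le> r y" "c x \<le> c z" "c z \<le> c y"
      using that by (auto simp: poset_iff)
    then have "r z = r x \<and> c z = c x \<or> r z = r y \<and> c z = c y" using adj by linarith
    then show ?thesis using coordinates_inj z(1) assms by blast
  qed
  then show ?cov using assms adj by (auto simp: poset_iff)
next
  assume cov: ?cov
  then have le: "r x \<le> r y" "c x \<le> c y" by (auto simp: poset_iff)
  have "r x \<noteq> r y \<or> c x \<noteq> c y" using cov assms coordinates_inj by blast
  then consider "c x < c y" | "c x = c y" "r x < r y" using le by linarith
  then show ?adj
  proof cases
    case 1
    then obtain z where z: "z \<in> {1..n}" "r z = r x" "c z = c x + 1"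
      using convex[of x y "r x" "c x + 1"] assms le by auto
    then have "(x, z) \<in> P" "(z, y) \<in> P" using assms le 1 by (auto simp: poset_iff)
    with cov have "z = x \<or> z = y" by blast
    with z show ?thesis by auto
  next
    case 2
    then obtain z where z: "z \<in> {1..n}" "r z = r x + 1" "c z = c x"
      using convex[of x y "r x + 1" "c x"] assms le by auto
    then have "(x, z) \<in> P" "(z, y) \<in> P" using assms le 2 by (auto simp: poset_iff)
    with cov have "z = x \<or> z = y" by blast
    with z show ?thesis by auto
  qed
qed

text \<open>
  Rows of a Schur labeling decrease and columns increase, so the labels tell a horizontal cover
  from a vertical one. Adjacency of boxes, with its direction, can therefore be read off the poset;
  uniqueness of the canonical labeling rests on this.
\<close>

lemma right_neighbour_iff:
  assumes "x \<in> {1..n}" "y \<in> {1..n}"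
  shows "r y = r x \<and> c y = c x + 1 \<longleftrightarrow>
    y < x \<and> (x, y) \<in> P \<and> (\<forall>z. (x, z) \<in> P \<and> (z, y) \<in> P \<longrightarrow> z = x \<or> z = y)"
  using cover_iff_adjacent[OF assms] row_decreasing[OF assms] column_increasing[OF assms] by auto

lemma lower_neighbour_iff:
  assumes "x \<in> {1..n}" "y \<in> {1..n}"
  shows "r y = r x + 1 \<and> c y = c x \<longleftrightarrow>
    x < y \<and> (x, y) \<in> P \<and> (\<forall>z. (x, z) \<in> P \<and> (z, y) \<in> P \<longrightarrow> z = x \<or> z = y)"
  using cover_iff_adjacent[OF assms] row_decreasing[OF assms] column_increasing[OF assms] by auto

end

section \<open>A poset determines its canonical coordinates\<close>

locale two_schur_coordinates = A: schur_coordinates n r c P + B: schur_coordinates n r' c' P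
  for n r c r' c' P
begin

text \<open>
  Walk from \<open>x\<close> to \<open>y\<close> through adjacent boxes of the first diagram. Every step is a step in the same
  direction in the second diagram, so the displacement between the diagrams does not change.
\<close>

lemma poset_translation:
  assumes "(x, y) \<in> P"
  shows "int (r' y) - int (r y) = int (r' x) - int (r x) \<and>
    int (c' y) - int (c y) = int (c' x) - int (c x)"
  using assms
proof (induction "(r y - r x) + (c y - c x)" arbitrary: x rule: less_induct)
  case less
  then have x: "x \<in> {1..n}" and y: "y \<in> {1..n}" and le: "r x \<le> r y" "c x \<le> c y"
    by (auto simp: A.poset_iff)
  consider "x = y" | "c x < c y" | "c x = c y" "r x < r y"
    using le A.coordinates_inj[OF x y] by linarith
  then show ?case
  proof cases
    case 2
    then obtain z where z: "z \<in> {1..n}" "r z = r x \<and> c z = c x + 1"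
      using A.convex[of x y "r x" "c x + 1"] x y le by auto
    then have "r' z = r' x \<and> c' z = c' x + 1"
      using A.right_neighbour_iff[OF x z(1)] B.right_neighbour_iff[OF x z(1)] by blast
    moreover have "(z, y) \<in> P" using z y le 2 by (simp add: A.poset_iff)
    ultimately show ?thesis using less.hyps[of z] z 2 by auto
  next
    case 3
    then obtain z where z: "z \<in> {1..n}" "r z = r x + 1 \<and> c z = c x"
      using A.convex[of x y "r x + 1" "c x"] x y le by auto
    then have "r' z = r' x + 1 \<and> c' z = c' x"
      using A.lower_neighbour_iff[OF x z(1)] B.lower_neighbour_iff[OF x z(1)] by blast
    moreover have "(z, y) \<in> P" using z y le 3 by (simp add: A.poset_iff)
    ultimately show ?thesis using less.hyps[of z] z 3 by auto
  qed simp
qed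

lemma connected_translation:
  assumes "(x, y) \<in> connected P"
  shows "int (r' y) - int (r y) = int (r' x) - int (r x) \<and>
    int (c' y) - int (c y) = int (c' x) - int (c x)"
  using assms unfolding connected_def
proof (induction rule: rtrancl_induct)
  case (step y z)
  then show ?case using poset_translation[of y z] poset_translation[of z y] by auto
qed simp

text \<open>
  Inside a component the two coordinate systems differ by a translation; between components both
  compare as the leaders do. So they order the labels by rows, and by columns, in the same way, and
  having no gaps they coincide.
\<close>

lemma canonical_coordinates_unique:
  assumes canA: "canonical_coordinates n r P" and canB: "canonical_coordinates n r' P"
    and x: "x \<in> {1..n}"
  shows "r x = r' x \<and> c x = c' x"
proof -
  have cmp: "(r x \<le> r y \<longleftrightarrow> r' x \<le> r' y) \<and> (c x \<le> c y \<longleftrightarrow> c' x \<le> c' y)"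
    if x: "x \<in> {1..n}" and y: "y \<in> {1..n}" for x y
  proof (cases "(x, y) \<in> connected P")
    case True
    then show ?thesis using connected_translation[of x y] by linarith
  next
    case False
    then have F': "(y, x) \<notin> connected P" using connected_sym by metis
    have "r x < r y \<longrightarrow> leader P x < leader P y" "r y < r x \<longrightarrow> leader P y < leader P x"
      "r' x < r' y \<longrightarrow> leader P x < leader P y" "r' y < r' x \<longrightarrow> leader P y < leader P x"
      using canA canB x y False F' unfolding canonical_coordinates_def by blast+
    then show ?thesis using A.incomparable[OF x y False] B.incomparable[OF x y False] by linarith
  qed
  obtain m where m: "r ` {1..n} = {1..m}" using A.rows_gapless ..
  obtain m' where m': "r' ` {1..n} = {1..m'}" using B.rows_gapless ..
  obtain k where k: "c ` {1..n} = {1..k}" using A.columns_gapless ..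
  obtain k' where k': "c' ` {1..n} = {1..k'}" using B.columns_gapless ..
  show ?thesis
    using gapless_coordinates_unique[OF m m' conjunct1[OF cmp] x]
      gapless_coordinates_unique[OF k k' conjunct2[OF cmp] x] by blast
qed

end

section \<open>Rearranging the components into canonical order\<close>

context schur_coordinates
begin

text \<open>
  Rows are sorted by component first and by the old row second. For columns the components are sorted
  the other way round, as an upper component has to lie to the right of a lower one. The ranks of
  these keys leave no gaps, hence no empty row and no empty column.
\<close>

definition row_key where "row_key x = (leader P x, r x)"
definition col_key where "col_key x = (n - leader P x, c x)"
definition new_row where "new_row x = rank (row_key ` {1..n}) (row_key x)"
definition new_col where "new_col x = rank (col_key ` {1..n}) (col_key x)"

lemma new_row_le_iff:
  assumes "x \<in> {1..n}" "y \<in> {1..n}"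
  shows "new_row x \<le> new_row y \<longleftrightarrow>
    leader P x < leader P y \<or> leader P x = leader P y \<and> r x \<le> r y"
  using assms unfolding new_row_def by (subst rank_le_iff) (auto simp: row_key_def)

lemma new_col_le_iff:
  assumes "x \<in> {1..n}" "y \<in> {1..n}"
  shows "new_col x \<le> new_col y \<longleftrightarrow>
    leader P y < leader P x \<or> leader P x = leader P y \<and> c x \<le> c y"
  using assms leader_in[of x] leader_in[of y]
  unfolding new_col_def by (subst rank_le_iff) (auto simp: col_key_def)

lemma new_row_image: "new_row ` {1..n} = {1..card (row_key ` {1..n})}"
  using bij_betw_imp_surj_on[OF bij_betw_rank, of "row_key ` {1..n}"]
  by (simp add: new_row_def image_image)

lemma new_col_image: "new_col ` {1..n} = {1..card (col_key ` {1..n})}"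
  using bij_betw_imp_surj_on[OF bij_betw_rank, of "col_key ` {1..n}"]
  by (simp add: new_col_def image_image)

lemma new_poset_iff:
  assumes "x \<in> {1..n}" "y \<in> {1..n}"
  shows "(x, y) \<in> P \<longleftrightarrow> new_row x \<le> new_row y \<and> new_col x \<le> new_col y"
  using assms leader_eq_iff[OF assms] connected_base[of x y P]
  by (auto simp: new_row_le_iff new_col_le_iff poset_iff)

lemma new_row_eqD:
  assumes "x \<in> {1..n}" "y \<in> {1..n}" "new_row x = new_row y"
  shows "leader P x = leader P y \<and> r x = r y"
  using new_row_le_iff[OF assms(1,2)] new_row_le_iff[OF assms(2,1)] assms(3) by auto

lemma new_col_eqD:
  assumes "x \<in> {1..n}" "y \<in> {1..n}" "new_col x = new_col y"
  shows "leader P x = leader P y \<and> c x = c y"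
  using new_col_le_iff[OF assms(1,2)] new_col_le_iff[OF assms(2,1)] assms(3) by auto

text \<open>
  The new coordinates compare labels of one component as the old ones do, and make different
  components incomparable. For convexity, a row and a column between those of two comparable boxes
  belong to the component of these boxes, where the old diagram supplies the box at their
  crossing.
\<close>

lemma schur_coordinates_new: "schur_coordinates n new_row new_col P"
proof
  fix x y assume x: "x \<in> {1..n}" and y: "y \<in> {1..n}"
  show "x = y" if "new_row x = new_row y" "new_col x = new_col y"
    using new_row_eqD[OF x y that(1)] new_col_eqD[OF x y that(2)] coordinates_inj[OF x y] by blast
  show "y < x" if "new_row x = new_row y" "new_col x < new_col y"
    using new_row_eqD[OF x y that(1)] row_decreasing[OF x y] that(2) new_col_le_iff[OF y x] by auto
  show "x < y" if "new_col x = new_col y" "new_row x < new_row y"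
    using new_col_eqD[OF x y that(1)] column_increasing[OF x y] that(2) new_row_le_iff[OF y x]
    by auto
  fix a b assume ab: "new_row x \<le> a" "a \<le> new_row y" "new_col x \<le> b" "b \<le> new_col y"
  have "new_row x \<in> new_row ` {1..n}" "new_row y \<in> new_row ` {1..n}"
    "new_col x \<in> new_col ` {1..n}" "new_col y \<in> new_col ` {1..n}" using x y by blast+
  then have "a \<in> new_row ` {1..n}" "b \<in> new_col ` {1..n}"
    using ab unfolding new_row_image new_col_image by auto
  then obtain z w where z: "z \<in> {1..n}" "new_row z = a" and w: "w \<in> {1..n}" "new_col w = b"
    by blast
  have L: "leader P x = leader P y"
    using ab new_row_le_iff[OF x y] new_col_le_iff[OF x y] by linarith
  have zz: "leader P z = leader P x" "r x \<le> r z" "r z \<le> r y"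
    using ab z L new_row_le_iff[OF x z(1)] new_row_le_iff[OF z(1) y] by auto
  have ww: "leader P w = leader P x" "c x \<le> c w" "c w \<le> c y"
    using ab w L new_col_le_iff[OF x w(1)] new_col_le_iff[OF w(1) y] by auto
  from convex[OF x y zz(2,3) ww(2,3)] obtain v where
    v: "v \<in> {1..n}" "r v = r z" "c v = c w" by blast
  have "(x, v) \<in> P" using x v zz ww by (simp add: poset_iff)
  then have Lv: "leader P v = leader P x" using leader_cong connected_base by metis
  have "new_row v = new_row z"
    using new_row_le_iff[OF v(1) z(1)] new_row_le_iff[OF z(1) v(1)] Lv zz v by auto
  moreover have "new_col v = new_col w"
    using new_col_le_iff[OF v(1) w(1)] new_col_le_iff[OF w(1) v(1)] Lv ww v by auto
  ultimately show "\<exists>z\<in>{1..n}. new_row z = a \<and> new_col z = b" using v z w by blast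
next
  fix x y
  show "(x, y) \<in> P \<longleftrightarrow>
    x \<in> {1..n} \<and> y \<in> {1..n} \<and> new_row x \<le> new_row y \<and> new_col x \<le> new_col y"
    using new_poset_iff poset_in by blast
qed (use new_row_image new_col_image in blast)+

lemma canonical_coordinates_new: "canonical_coordinates n new_row P"
  unfolding canonical_coordinates_def
proof (intro ballI impI)
  fix x y assume xy: "x \<in> {1..n}" "y \<in> {1..n}" "(x, y) \<notin> connected P" "new_row x < new_row y"
  then have "leader P x \<noteq> leader P y" using leader_eq_iff by blast
  then show "leader P x < leader P y" using xy(4) new_row_le_iff[OF xy(2,1)] by linarith
qed

end

section \<open>Labels along anti-diagonal directions in a regular poset\<close>

context schur_coordinates
begin

text \<open>
  If labels of one component lay on both sides of \<open>y\<close>, a path of comparable labels between them would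
  jump over \<open>y\<close> in a single step. Regularity, applied to this step, makes \<open>y\<close> comparable to one of its
  ends and so puts \<open>y\<close> into the component.
\<close>

lemma regular_connected_interval:
  assumes reg: "regular_poset n P" and x: "x \<in> {1..n}" and xz: "(x, z) \<in> connected P"
    and y: "y \<in> {1..n}" and xy: "(x, y) \<notin> connected P" and less: "x < y"
  shows "z < y"
  using xz unfolding connected_def
proof (induction rule: rtrancl_induct)
  case base
  show ?case using less .
next
  case (step u v)
  have u: "(x, u) \<in> connected P" and v: "(x, v) \<in> connected P"
    using step.hyps by (auto simp: connected_def intro: rtrancl_into_rtrancl)
  have in_n: "u \<in> {1..n}" "v \<in> {1..n}" using connected_in[OF u x] connected_in[OF v x] by auto
  have not: "(u, y) \<notin> P" "(y, u) \<notin> P" "(v, y) \<notin> P" "(y, v) \<notin> P"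
    using xy u v connected_base connected_sym connected_trans by metis+
  show ?case
  proof (rule ccontr)
    assume "\<not> v < y"
    moreover have "v \<noteq> y" using v xy by blast
    ultimately have "u < y" "y < v" using step.IH by auto
    with reg in_n y not step.hyps(2) show False unfolding regular_poset_def by blast
  qed
qed

text \<open>
  No leader lies inside the range of another component, so the order of the leaders is inherited by
  all labels of the two components.
\<close>

lemma regular_connected_classes:
  assumes reg: "regular_poset n P" and x: "x \<in> {1..n}" and y: "y \<in> {1..n}"
    and xy: "(x, y) \<notin> connected P" and less: "leader P x < leader P y"
  shows "x < y"
proof -
  let ?x = "leader P x" and ?y = "leader P y"
  have cx: "(?x, x) \<in> connected P" and cy: "(y, ?y) \<in> connected P"
    using leader_connected x y connected_sym by metis+
  have not: "(?x, ?y) \<notin> connected P" using cx cy xy connected_trans connected_sym by metis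
  have "x < ?y"
    using regular_connected_interval[OF reg leader_in[OF x] cx leader_in[OF y] not less] .
  also have "?y \<le> y" using leader_le[OF y] by simp
  finally show ?thesis .
qed

text \<open>
  If the box in the row of \<open>y\<close> and the column of \<open>x\<close> is in the diagram, its label lies between \<open>x\<close>
  and \<open>y\<close>. Otherwise, as the row above that of \<open>y\<close> shares a column with it, that row contains a box
  with a label below \<open>y\<close> that is still to the left of \<open>x\<close>; repeat from there.
\<close>

lemma north_east_less_same_component:
  assumes "x \<in> {1..n}" "y \<in> {1..n}" "r x < r y" "c y < c x"
    and "\<And>a. r x \<le> a \<Longrightarrow> a < r y \<Longrightarrow> rows_joined n r c a"
  shows "x < y"
  using assms
proof (induction "r y - r x" arbitrary: y)
  case 0
  then show ?case by simp
next
  case (Suc k)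
  note x = Suc.prems(1) and y = Suc.prems(2)
  have "rows_joined n r c (r y - 1)" using Suc.prems by simp
  then obtain u v where u: "u \<in> {1..n}" "r u = r y - 1"
    and v: "v \<in> {1..n}" "r v = r y" "c u = c v"
    using Suc.prems(3) unfolding rows_joined_def by auto
  have ru: "r u < r y" "r x \<le> r u" using u Suc.prems(3) by auto
  show ?case
  proof (cases "c x \<le> c v")
    case True
    obtain w where w: "w \<in> {1..n}" "r w = r y" "c w = c x"
      using convex[of y v "r y" "c x"] y v True Suc.prems(4) by auto
    \<comment> \<open>\<open>w\<close> lies below \<open>x\<close> and to the right of \<open>y\<close>\<close>
    have "x < w" using column_increasing[OF x w(1)] w Suc.prems(3) by simp
    also have "w < y" using row_decreasing[OF y w(1)] w Suc.prems(4) by simp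
    finally show ?thesis .
  next
    case False
    \<comment> \<open>either the box above \<open>y\<close>, or a box further right that is reached from \<open>y\<close> by going right, then up\<close>
    obtain w where w: "w \<in> {1..n}" "r w = r u" "c w = max (c v) (c y)" "w < y"
    proof (cases "c v \<le> c y")
      case True
      then obtain w where w: "w \<in> {1..n}" "r w = r u" "c w = c y"
        using convex[of u y "r u" "c y"] y u(1) v ru by auto
      then have "w < y" using column_increasing[OF w(1) y] ru by simp
      then show ?thesis using that w True by simp
    next
      case False
      have "u < v" using column_increasing[OF u(1) v(1)] v ru by simp
      also have "v < y" using row_decreasing[OF y v(1)] v False by simp
      finally show ?thesis using that[of u] u v False by simp
    qed
    have cw: "c w < c x" using w False Suc.prems(4) by simp
    have "x < w"
    proof (cases "r x = r u")
      case True
      then show ?thesis using row_decreasing[OF w(1) x] w cw by simp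
    next
      case False
      show ?thesis
      proof (rule Suc.hyps(1))
        show "k = r w - r x" using Suc.hyps(2) u w by simp
        show "\<And>a. r x \<le> a \<Longrightarrow> a < r w \<Longrightarrow> rows_joined n r c a"
          using Suc.prems(5) w ru by simp
      qed (use x w cw False ru in auto)
    qed
    with w show ?thesis by simp
  qed
qed

text \<open>
  This is the decisive consequence of regularity: labels increase from north-east to south-west, the
  direction in which the poset makes no comparison.
\<close>

lemma north_east_less:
  assumes reg: "regular_poset n P" and can: "canonical_coordinates n r P"
    and x: "x \<in> {1..n}" and y: "y \<in> {1..n}" and ne: "r x < r y" "c y < c x"
  shows "x < y"
proof (cases "(x, y) \<in> connected P")
  case True
  then show ?thesis
    using north_east_less_same_component[OF x y ne] connected_imp_rows_joined[OF True] ne by simp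
next
  case False
  then have "leader P x < leader P y"
    using can x y ne unfolding canonical_coordinates_def by blast
  then show ?thesis using regular_connected_classes[OF reg x y False] by blast
qed

end

section \<open>Skew diagrams as convex sets\<close>

lemma part_antimono:
  assumes "is_partition l" "1 \<le> i" "i \<le> j"
  shows "part l j \<le> part l i"
proof (cases "j \<le> length l \<and> i < j")
  case True
  then have "l ! (j - 1) \<le> l ! (i - 1)"
    using assms sorted_wrt_nth_less[of "(\<ge>)" l "i - 1" "j - 1"] by (auto simp: is_partition_def)
  then show ?thesis using True assms by (simp add: part_def)
next
  case False
  then show ?thesis using assms by (auto simp: part_def)
qed

lemma part_pos_iff:
  assumes "is_partition l"
  shows "0 < part l i \<longleftrightarrow> i \<in> {1..length l}"
proof (cases "i \<in> {1..length l}")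
  case True
  then have "l ! (i - 1) \<in> set l" by (intro nth_mem) auto
  with assms have "l ! (i - 1) \<noteq> 0" unfolding is_partition_def by metis
  with True show ?thesis by (simp add: part_def)
qed (auto simp: part_def)

lemma partition_eqI:
  assumes l: "is_partition l" and l': "is_partition l'"
    and eq: "\<And>i. 1 \<le> i \<Longrightarrow> part l i = part l' i"
  shows "l = l'"
proof (rule nth_equalityI)
  have "i \<in> {1..length l} \<longleftrightarrow> i \<in> {1..length l'}" for i
    using part_pos_iff[OF l, of i] part_pos_iff[OF l', of i] eq[of i] by auto
  then show len: "length l = length l'"
    by (metis atLeastAtMost_iff le_antisym le_numeral_extra(4) less_one linorder_not_le nat_le_linear)
  fix i assume "i < length l"
  then show "l ! i = l' ! i" using eq[of "i + 1"] len by (simp add: part_def)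
qed

text \<open>
  The inner partition of a skew shape may vanish on some rows although these have boxes, so a weakly
  decreasing list of row bounds has to lose its trailing zeros to become a partition.
\<close>

lemma part_filter_nonzero:
  assumes "sorted_wrt (\<ge>) l"
  shows "part (filter (\<lambda>x. x \<noteq> 0) l) i = part l i"
  using assms
proof (induction l arbitrary: i)
  case (Cons x l)
  show ?case
  proof (cases "x = 0")
    case True
    then have zero: "\<forall>y\<in>set (x # l). y = 0" using Cons.prems by auto
    then have "filter (\<lambda>x. x \<noteq> 0) (x # l) = []" by (simp add: filter_empty_conv)
    moreover have "part (x # l) i = 0"
      using zero nth_mem[of "i - 1" "x # l"] unfolding part_def by auto
    ultimately show ?thesis by (simp add: part_def)
  next
    case False
    have "part (y # k) i = (if i = 1 then y else part k (i - 1))" for y k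
      by (cases "i - 1") (auto simp: part_def)
    then show ?thesis using Cons False by simp
  qed
qed simp

lemma diagram_convex:
  assumes sh: "is_skew_partition sh" and b: "(i, j) \<in> diagram sh" and c: "(i', j') \<in> diagram sh"
    and le: "i \<le> a" "a \<le> i'" "j \<le> b" "b \<le> j'"
  shows "(a, b) \<in> diagram sh"
proof -
  have "part (snd sh) a \<le> part (snd sh) i" "part (fst sh) i' \<le> part (fst sh) a"
    using sh b le by (auto intro!: part_antimono simp: is_skew_partition_def diagram_def)
  then show ?thesis using b c le by (auto simp: diagram_def)
qed

lemma fst_diagram:
  assumes "is_basic_skew sh"
  shows "fst ` diagram sh = {1..length (fst sh)}"
proof
  show "fst ` diagram sh \<subseteq> {1..length (fst sh)}"
    by (auto simp: diagram_def part_def split: if_splits)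
  show "{1..length (fst sh)} \<subseteq> fst ` diagram sh"
    using assms by (force simp: is_basic_skew_def is_basic_def)
qed

lemma snd_diagram:
  assumes "is_basic_skew sh"
  shows "snd ` diagram sh = {1..part (fst sh) 1}"
proof
  show "snd ` diagram sh \<subseteq> {1..part (fst sh) 1}"
  proof
    fix j assume "j \<in> snd ` diagram sh"
    then obtain i where i: "(i, j) \<in> diagram sh" by force
    then have "part (fst sh) i \<le> part (fst sh) 1"
      using assms part_antimono[of "fst sh" 1 i]
      by (auto simp: is_basic_skew_def is_skew_partition_def diagram_def)
    with i show "j \<in> {1..part (fst sh) 1}" by (auto simp: diagram_def)
  qed
  show "{1..part (fst sh) 1} \<subseteq> snd ` diagram sh"
    using assms by (force simp: is_basic_skew_def is_basic_def)
qed

lemma basic_row_nonempty_iff: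
  assumes "is_basic_skew sh" "1 \<le> i"
  shows "part (snd sh) i < part (fst sh) i \<longleftrightarrow> 0 < part (fst sh) i"
proof
  assume "0 < part (fst sh) i"
  then have "i \<in> {1..length (fst sh)}"
    using assms part_pos_iff by (auto simp: is_basic_skew_def is_skew_partition_def)
  then have "i \<in> fst ` diagram sh" using fst_diagram[OF assms(1)] by blast
  then show "part (snd sh) i < part (fst sh) i" by (auto simp: diagram_def)
qed simp

text \<open>
  Since no row is empty, the ends of the rows of the diagram determine all parts of both
  partitions.
\<close>

lemma basic_skew_shape_eqI:
  assumes sh: "is_basic_skew sh" and sh': "is_basic_skew sh'" and eq: "diagram sh = diagram sh'"
  shows "sh = sh'"
proof -
  have row: "{j. part (snd sh) i < j \<and> j \<le> part (fst sh) i}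
      = {j. part (snd sh') i < j \<and> j \<le> part (fst sh') i}" if "1 \<le> i" for i
    using eq that by (auto simp: diagram_def set_eq_iff)
  have parts: "part (fst sh) i = part (fst sh') i \<and> part (snd sh) i = part (snd sh') i"
    if i: "1 \<le> i" for i
  proof -
    let ?a = "part (snd sh) i" and ?b = "part (fst sh) i"
      and ?a' = "part (snd sh') i" and ?b' = "part (fst sh') i"
    have le: "?a \<le> ?b" "?a' \<le> ?b'"
      using sh sh' by (auto simp: is_basic_skew_def is_skew_partition_def)
    have "?a < ?b \<longleftrightarrow> 0 < ?b" "?a' < ?b' \<longleftrightarrow> 0 < ?b'"
      using basic_row_nonempty_iff sh sh' i by blast+
    moreover have mem: "?a < j \<and> j \<le> ?b \<longleftrightarrow> ?a' < j \<and> j \<le> ?b'" for j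
      using row[OF i] by blast
    have "?b \<le> ?a \<and> ?b' \<le> ?a' \<or> ?a = ?a' \<and> ?b = ?b'"
      using mem[of ?b] mem[of ?b'] mem[of "?a + 1"] mem[of "?a' + 1"] by linarith
    ultimately show ?thesis using le by linarith
  qed
  have "fst sh = fst sh'" "snd sh = snd sh'"
    using sh sh' parts by (auto intro!: partition_eqI simp: is_basic_skew_def is_skew_partition_def)
  then show ?thesis by (simp add: prod_eq_iff)
qed

text \<open>
  The rows of a convex set are intervals. Were a right end to move right on going down, the upper right
  corner of the rectangle spanned by the two boxes would be missing; likewise for the left ends. So
  the ends of the rows form two partitions.
\<close>

lemma convex_set_is_basic_skew_diagram:
  assumes fin: "finite D" and rows: "fst ` D = {1..m}" and cols: "snd ` D = {1..k}"
    and conv: "\<And>i j i' j' a b. (i, j) \<in> D \<Longrightarrow> (i', j') \<in> D \<Longrightarrow>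
      i \<le> a \<Longrightarrow> a \<le> i' \<Longrightarrow> j \<le> b \<Longrightarrow> b \<le> j' \<Longrightarrow> (a, b) \<in> D"
  shows "\<exists>sh. is_basic_skew sh \<and> diagram sh = D"
proof -
  define hi where "hi i = Max {j. (i, j) \<in> D}" for i
  define lo where "lo i = Min {j. (i, j) \<in> D} - 1" for i
  define la where "la = map hi [1..<Suc m]"
  define mu' where "mu' = map lo [1..<Suc m]"
  define mu where "mu = filter (\<lambda>x. x \<noteq> 0) mu'"
  have finrow: "finite {j. (i, j) \<in> D}" for i
    by (rule finite_subset[of _ "snd ` D"]) (use fin in force)+
  have nonempty: "{j. (i, j) \<in> D} \<noteq> {}" if "i \<in> {1..m}" for i
    using rows that by force
  have pos: "1 \<le> j \<and> j \<le> k \<and> 1 \<le> i \<and> i \<le> m" if "(i, j) \<in> D" for i j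
  proof -
    have "i \<in> fst ` D" "j \<in> snd ` D" using that by force+
    then show ?thesis unfolding rows cols by simp
  qed
  have hi: "(i, hi i) \<in> D" if "i \<in> {1..m}" for i
    using Max_in[OF finrow nonempty[OF that]] by (simp add: hi_def)
  have hi_ge: "j \<le> hi i" if "(i, j) \<in> D" for i j
    using Max_ge[OF finrow, of j i] that by (simp add: hi_def)
  have lo: "(i, lo i + 1) \<in> D" if "i \<in> {1..m}" for i
  proof -
    have "(i, Min {j. (i, j) \<in> D}) \<in> D" using Min_in[OF finrow nonempty[OF that]] by simp
    with pos[OF this] show ?thesis by (simp add: lo_def)
  qed
  have lo_less: "lo i < j" if "(i, j) \<in> D" for i j
    using Min_le[OF finrow, of j i] that pos[OF that] by (auto simp: lo_def)
  have row: "(i, j) \<in> D \<longleftrightarrow> lo i < j \<and> j \<le> hi i" if "i \<in> {1..m}" for i j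
    using hi_ge lo_less conv[OF lo[OF that] hi[OF that], of i j] by auto
  have hi_anti: "hi i' \<le> hi i" if i: "i \<in> {1..m}" "i' \<in> {1..m}" "i \<le> i'" for i i'
  proof (rule ccontr)
    assume "\<not> hi i' \<le> hi i"
    then have "(i, hi i') \<in> D" using conv[OF hi[OF i(1)] hi[OF i(2)], of i "hi i'"] i by simp
    then show False using hi_ge \<open>\<not> hi i' \<le> hi i\<close> by blast
  qed
  have lo_anti: "lo i' \<le> lo i" if i: "i \<in> {1..m}" "i' \<in> {1..m}" "i \<le> i'" for i i'
  proof (rule ccontr)
    assume *: "\<not> lo i' \<le> lo i"
    then have "(i', lo i + 1) \<in> D"
      using conv[OF lo[OF i(1)] lo[OF i(2)], of i' "lo i + 1"] i by simp
    then show False using lo_less[of i' "lo i + 1"] * by simp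
  qed
  have sorted: "sorted_wrt (\<ge>) (map f [1..<Suc m])"
    if "\<And>i i'. i \<in> {1..m} \<Longrightarrow> i' \<in> {1..m} \<Longrightarrow> i \<le> i' \<Longrightarrow> f i' \<le> f i" for f :: "nat \<Rightarrow> nat"
    using that by (simp add: sorted_wrt_iff_nth_less del: upt_Suc)
  have part_map: "part (map f [1..<Suc m]) i = (if i \<in> {1..m} then f i else 0)" for f i
    by (auto simp: part_def simp del: upt_Suc)
  have part_la: "part la i = (if i \<in> {1..m} then hi i else 0)" for i
    unfolding la_def by (rule part_map)
  have mu'_sorted: "sorted_wrt (\<ge>) mu'" unfolding mu'_def using lo_anti by (rule sorted)
  have part_mu: "part mu i = (if i \<in> {1..m} then lo i else 0)" for i
    unfolding mu_def part_filter_nonzero[OF mu'_sorted] unfolding mu'_def by (rule part_map)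
  have "is_partition la"
  proof -
    have "0 \<notin> set la"
    proof
      assume "0 \<in> set la"
      then obtain i where "i \<in> {1..m}" "hi i = 0"
        by (auto simp: la_def less_Suc_eq_le simp del: upt_Suc)
      with pos[OF hi[of i]] show False by simp
    qed
    moreover have "sorted_wrt (\<ge>) la" unfolding la_def using hi_anti by (rule sorted)
    ultimately show ?thesis by (simp add: is_partition_def)
  qed
  moreover have "is_partition mu"
    using mu'_sorted by (auto simp: is_partition_def mu_def intro: sorted_wrt_filter)
  moreover have "part mu i \<le> part la i" for i
    using lo_less[OF hi, of i] by (auto simp: part_la part_mu)
  ultimately have "is_skew_partition (la, mu)" by (simp add: is_skew_partition_def)
  moreover have dia: "diagram (la, mu) = D"
  proof (rule set_eqI)
    fix x :: box
    obtain i j where x: "x = (i, j)" by (cases x)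
    show "x \<in> diagram (la, mu) \<longleftrightarrow> x \<in> D"
    proof (cases "i \<in> {1..m}")
      case True
      then have "part la i = hi i" "part mu i = lo i" "1 \<le> i" by (simp_all add: part_la part_mu)
      then show ?thesis using row[OF True, of j] by (simp add: x diagram_def)
    next
      case False
      then have "part la i = 0" by (simp only: part_la if_False)
      moreover have "(i, j) \<notin> D" using pos[of i j] False by auto
      ultimately show ?thesis by (simp add: x diagram_def)
    qed
  qed
  moreover have "is_basic (la, mu)"
    unfolding is_basic_def dia fst_conv
  proof (intro conjI ballI)
    fix i assume "i \<in> {1..length la}"
    then have "i \<in> {1..m}" by (simp add: la_def del: upt_Suc)
    then show "\<exists>j. (i, j) \<in> D" using hi by blast
  next
    fix j assume j: "j \<in> {1..part la 1}"
    then have "1 \<in> {1..m}" by (auto simp: part_la split: if_splits)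
    then have "part la 1 \<le> k" using pos[OF hi, of 1] by (simp add: part_la)
    with j have "j \<in> snd ` D" unfolding cols by simp
    then show "\<exists>i. (i, j) \<in> D" by force
  qed
  ultimately show ?thesis unfolding is_basic_skew_def by blast
qed

section \<open>Schur labelings and their coordinates\<close>

abbreviation label_row :: "skew_shape \<Rightarrow> (box \<Rightarrow> nat) \<Rightarrow> nat \<Rightarrow> nat" where
  "label_row sh \<tau> x \<equiv> fst (box_of sh \<tau> x)"

abbreviation label_col :: "skew_shape \<Rightarrow> (box \<Rightarrow> nat) \<Rightarrow> nat \<Rightarrow> nat" where
  "label_col sh \<tau> x \<equiv> snd (box_of sh \<tau> x)"

lemma bij_betw_box_of:
  "bijective_tableau n sh \<tau> \<Longrightarrow> bij_betw (box_of sh \<tau>) {1..n} (diagram sh)"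
  unfolding bijective_tableau_def box_of_def by (auto intro: bij_betw_the_inv_into)

lemma box_of_apply:
  "bijective_tableau n sh \<tau> \<Longrightarrow> b \<in> diagram sh \<Longrightarrow> box_of sh \<tau> (\<tau> b) = b"
  unfolding bijective_tableau_def box_of_def by (auto simp: bij_betw_def the_inv_into_f_f)

lemma apply_box_of:
  "bijective_tableau n sh \<tau> \<Longrightarrow> x \<in> {1..n} \<Longrightarrow> \<tau> (box_of sh \<tau> x) = x"
  unfolding bijective_tableau_def box_of_def by (auto simp: bij_betw_def f_the_inv_into_f)

lemma box_of_in: "bijective_tableau n sh \<tau> \<Longrightarrow> x \<in> {1..n} \<Longrightarrow> box_of sh \<tau> x \<in> diagram sh"
  using bij_betw_box_of bij_betwE by metis

lemma label_in: "bijective_tableau n sh \<tau> \<Longrightarrow> b \<in> diagram sh \<Longrightarrow> \<tau> b \<in> {1..n}"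
  unfolding bijective_tableau_def using bij_betwE by metis

lemma schur_coordinates_of_labeling:
  assumes sh: "is_basic_skew sh" and \<tau>: "schur_labeling n sh \<tau>"
  shows "schur_coordinates n (label_row sh \<tau>) (label_col sh \<tau>) (tableau_poset n sh \<tau>)"
proof -
  have bt: "bijective_tableau n sh \<tau>" using \<tau> by (simp add: schur_labeling_def)
  have img: "box_of sh \<tau> ` {1..n} = diagram sh" using bij_betw_box_of[OF bt] by (simp add: bij_betw_def)
  show ?thesis
  proof
    fix x y assume x: "x \<in> {1..n}" and y: "y \<in> {1..n}"
    have x': "(label_row sh \<tau> x, label_col sh \<tau> x) \<in> diagram sh"
      and y': "(label_row sh \<tau> y, label_col sh \<tau> y) \<in> diagram sh"
      and labels: "\<tau> (label_row sh \<tau> x, label_col sh \<tau> x) = x"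
        "\<tau> (label_row sh \<tau> y, label_col sh \<tau> y) = y"
      using box_of_in[OF bt] apply_box_of[OF bt] x y by simp_all
    show "x = y" if "label_row sh \<tau> x = label_row sh \<tau> y" "label_col sh \<tau> x = label_col sh \<tau> y"
      using labels that by simp
    show "y < x" if "label_row sh \<tau> x = label_row sh \<tau> y" "label_col sh \<tau> x < label_col sh \<tau> y"
      using \<tau> x' y' labels that unfolding schur_labeling_def by metis
    show "x < y" if "label_col sh \<tau> x = label_col sh \<tau> y" "label_row sh \<tau> x < label_row sh \<tau> y"
      using \<tau> x' y' labels that unfolding schur_labeling_def by metis
    fix a b
    assume "label_row sh \<tau> x \<le> a" "a \<le> label_row sh \<tau> y"
      "label_col sh \<tau> x \<le> b" "b \<le> label_col sh \<tau> y"
    with sh have "(a, b) \<in> diagram sh"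
      using diagram_convex[OF _ x' y'] by (simp add: is_basic_skew_def)
    then show "\<exists>z\<in>{1..n}. label_row sh \<tau> z = a \<and> label_col sh \<tau> z = b"
      using box_of_apply[OF bt] label_in[OF bt] by (intro bexI[of _ "\<tau> (a, b)"]) simp_all
  next
    show "\<exists>m. label_row sh \<tau> ` {1..n} = {1..m}"
      using fst_diagram[OF sh] unfolding img[symmetric] image_image by blast
    show "\<exists>m. label_col sh \<tau> ` {1..n} = {1..m}"
      using snd_diagram[OF sh] unfolding img[symmetric] image_image by blast
  qed (auto simp: tableau_poset_def)
qed

text \<open>
  Linked rows of the shape are joined rows of the coordinates, so this is
  \<open>connected_iff_rows_joined\<close> read in the diagram.
\<close>

lemma component_rel_iff_connected:
  assumes sh: "is_basic_skew sh" and \<tau>: "schur_labeling n sh \<tau>"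
    and b: "b \<in> diagram sh" and c: "c \<in> diagram sh"
  shows "(b, c) \<in> component_rel sh \<longleftrightarrow> (\<tau> b, \<tau> c) \<in> connected (tableau_poset n sh \<tau>)"
proof -
  have bt: "bijective_tableau n sh \<tau>" using \<tau> by (simp add: schur_labeling_def)
  have joined: "rows_joined n (label_row sh \<tau>) (label_col sh \<tau>) a \<longleftrightarrow> rows_linked sh a" for a
  proof
    assume "rows_joined n (label_row sh \<tau>) (label_col sh \<tau>) a"
    then obtain x y where "x \<in> {1..n}" "y \<in> {1..n}" "label_row sh \<tau> x = a"
      "label_row sh \<tau> y = a + 1" "label_col sh \<tau> x = label_col sh \<tau> y"
      unfolding rows_joined_def by blast
    then show "rows_linked sh a"
      using box_of_in[OF bt, of x] box_of_in[OF bt, of y] unfolding rows_linked_def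
      by (metis prod.collapse)
  next
    assume "rows_linked sh a"
    then obtain j where j: "(a, j) \<in> diagram sh" "(a + 1, j) \<in> diagram sh"
      unfolding rows_linked_def by blast
    show "rows_joined n (label_row sh \<tau>) (label_col sh \<tau>) a"
      unfolding rows_joined_def
      by (rule bexI[OF _ label_in[OF bt j(1)]], rule bexI[OF _ label_in[OF bt j(2)]])
        (simp only: box_of_apply[OF bt j(1)] box_of_apply[OF bt j(2)] fst_conv snd_conv simp_thms)
  qed
  show ?thesis
    unfolding schur_coordinates.connected_iff_rows_joined[OF schur_coordinates_of_labeling[OF sh \<tau>]
        label_in[OF bt b] label_in[OF bt c]] box_of_apply[OF bt b] box_of_apply[OF bt c] joined
    using b c by (simp add: component_rel_def)
qed

lemma label_component:
  assumes sh: "is_basic_skew sh" and \<tau>: "schur_labeling n sh \<tau>" and b: "b \<in> diagram sh"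
  shows "\<tau> ` (component_rel sh `` {b}) = connected (tableau_poset n sh \<tau>) `` {\<tau> b}"
proof -
  interpret schur_coordinates n "label_row sh \<tau>" "label_col sh \<tau>" "tableau_poset n sh \<tau>"
    by (rule schur_coordinates_of_labeling[OF sh \<tau>])
  have bt: "bijective_tableau n sh \<tau>" using \<tau> by (simp add: schur_labeling_def)
  show ?thesis
  proof (intro set_eqI iffI)
    fix x assume "x \<in> \<tau> ` (component_rel sh `` {b})"
    then obtain c where "(b, c) \<in> component_rel sh" "x = \<tau> c" by blast
    moreover from this have "c \<in> diagram sh" by (simp add: component_rel_def)
    ultimately show "x \<in> connected (tableau_poset n sh \<tau>) `` {\<tau> b}"
      using component_rel_iff_connected[OF sh \<tau> b] by simp
  next
    fix x assume x: "x \<in> connected (tableau_poset n sh \<tau>) `` {\<tau> b}"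
    then have xn: "x \<in> {1..n}" using connected_in label_in[OF bt b] by blast
    have "(b, box_of sh \<tau> x) \<in> component_rel sh"
      using x component_rel_iff_connected[OF sh \<tau> b box_of_in[OF bt xn]] apply_box_of[OF bt xn]
      by simp
    then show "x \<in> \<tau> ` (component_rel sh `` {b})"
      using apply_box_of[OF bt xn] by (intro image_eqI[of _ _ "box_of sh \<tau> x"]) auto
  qed
qed

text \<open>
  Each component is the image of a class of \<open>connected\<close>, its minimum entry is the leader of that
  class, and one component is above another as soon as two of their boxes show it. This turns the
  condition on components into one on pairs of labels.
\<close>

lemma is_canonical_labeling_iff:
  "is_canonical_labeling n P sh \<tau> \<longleftrightarrow> is_basic_skew sh \<and> schur_labeling n sh \<tau> \<and>
     tableau_poset n sh \<tau> = P \<and> canonical_coordinates n (label_row sh \<tau>) P"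
proof -
  have "(\<forall>C\<in>components sh. \<forall>C'\<in>components sh. is_above C C' \<longrightarrow> Min (\<tau> ` C) < Min (\<tau> ` C'))
      \<longleftrightarrow> canonical_coordinates n (label_row sh \<tau>) P"
    if sh: "is_basic_skew sh" and \<tau>: "schur_labeling n sh \<tau>" and P: "P = tableau_poset n sh \<tau>"
  proof -
    interpret schur_coordinates n "label_row sh \<tau>" "label_col sh \<tau>" P
      unfolding P by (rule schur_coordinates_of_labeling[OF sh \<tau>])
    have bt: "bijective_tableau n sh \<tau>" using \<tau> by (simp add: schur_labeling_def)
    note rel = component_rel_iff_connected[OF sh \<tau>, folded P]
    have Min: "Min (\<tau> ` (component_rel sh `` {b})) = leader P (\<tau> b)" if "b \<in> diagram sh" for b
      unfolding leader_def label_component[OF sh \<tau> that, folded P] ..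
    have above: "is_above (component_rel sh `` {b}) (component_rel sh `` {c}) \<longleftrightarrow>
        (\<tau> b, \<tau> c) \<notin> connected P \<and> fst b < fst c"
      if b: "b \<in> diagram sh" and c: "c \<in> diagram sh" for b c
    proof
      have bb: "(b, b) \<in> component_rel sh" and cc: "(c, c) \<in> component_rel sh"
        using rel b c by simp_all
      assume *: "is_above (component_rel sh `` {b}) (component_rel sh `` {c})"
      have "(b, c) \<notin> component_rel sh"
        using * cc unfolding is_above_def by blast
      then show "(\<tau> b, \<tau> c) \<notin> connected P \<and> fst b < fst c"
        using * bb cc rel[OF b c] unfolding is_above_def by blast
    next
      assume *: "(\<tau> b, \<tau> c) \<notin> connected P \<and> fst b < fst c"
      show "is_above (component_rel sh `` {b}) (component_rel sh `` {c})"
        unfolding is_above_def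
      proof (intro ballI)
        fix b' c' assume b': "b' \<in> component_rel sh `` {b}" and c': "c' \<in> component_rel sh `` {c}"
        then have D: "b' \<in> diagram sh" "c' \<in> diagram sh" by (auto simp: component_rel_def)
        then have "(\<tau> b, \<tau> b') \<in> connected P" "(\<tau> c, \<tau> c') \<in> connected P"
          using rel b c b' c' by auto
        from connected_classes_row_separated[OF label_in[OF bt b] label_in[OF bt c] _ _ this] *
        show "fst b' < fst c'" using b c D by (simp add: box_of_apply[OF bt])
      qed
    qed
    have "(\<forall>C\<in>components sh. \<forall>C'\<in>components sh. is_above C C' \<longrightarrow> Min (\<tau> ` C) < Min (\<tau> ` C'))
        \<longleftrightarrow> (\<forall>b\<in>diagram sh. \<forall>c\<in>diagram sh. (\<tau> b, \<tau> c) \<notin> connected P \<and> fst b < fst c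
            \<longrightarrow> leader P (\<tau> b) < leader P (\<tau> c))"
      by (simp add: components_def quotient_def Min above)
    also have "\<dots> \<longleftrightarrow> (\<forall>b\<in>box_of sh \<tau> ` {1..n}. \<forall>c\<in>box_of sh \<tau> ` {1..n}.
        (\<tau> b, \<tau> c) \<notin> connected P \<and> fst b < fst c \<longrightarrow> leader P (\<tau> b) < leader P (\<tau> c))"
      using bij_betw_box_of[OF bt] by (simp add: bij_betw_def)
    also have "\<dots> \<longleftrightarrow> canonical_coordinates n (label_row sh \<tau>) P"
      unfolding canonical_coordinates_def by (simp add: apply_box_of[OF bt] imp_conjL)
    finally show ?thesis .
  qed
  then show ?thesis unfolding is_canonical_labeling_def by blast
qed

lemma schur_labeling_of_coordinates:
  assumes "schur_coordinates n r c P"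
  obtains sh \<tau> where "is_basic_skew sh" "schur_labeling n sh \<tau>" "tableau_poset n sh \<tau> = P"
    "\<And>x. x \<in> {1..n} \<Longrightarrow> box_of sh \<tau> x = (r x, c x)"
proof -
  interpret schur_coordinates n r c P by fact
  define f where "f x = (r x, c x)" for x
  define D where "D = f ` {1..n}"
  have bij: "bij_betw f {1..n} D"
    using coordinates_inj by (auto simp: bij_betw_def D_def f_def inj_on_def)
  obtain m where m: "r ` {1..n} = {1..m}" using rows_gapless ..
  obtain k where k: "c ` {1..n} = {1..k}" using columns_gapless ..
  have "\<exists>sh. is_basic_skew sh \<and> diagram sh = D"
  proof (rule convex_set_is_basic_skew_diagram)
    show "fst ` D = {1..m}" "snd ` D = {1..k}"
      using m k by (simp_all add: D_def f_def image_image)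
    fix i j i' j' a b assume "(i, j) \<in> D" "(i', j') \<in> D"
      and le: "i \<le> a" "a \<le> i'" "j \<le> b" "b \<le> j'"
    then obtain x y where "x \<in> {1..n}" "y \<in> {1..n}" "i = r x" "j = c x" "i' = r y" "j' = c y"
      by (auto simp: D_def f_def)
    with le convex[of x y a b] obtain z where "z \<in> {1..n}" "r z = a" "c z = b" by auto
    then show "(a, b) \<in> D" unfolding D_def f_def by blast
  qed (simp add: D_def)
  then obtain sh where sh: "is_basic_skew sh" "diagram sh = D" by blast
  define \<tau> where "\<tau> = restrict (the_inv_into {1..n} f) D"
  have \<tau>f: "\<tau> (f x) = x" if "x \<in> {1..n}" for x
    using bij that by (auto simp: \<tau>_def D_def bij_betw_def the_inv_into_f_f)
  have bt: "bijective_tableau n sh \<tau>"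
    using bij_betw_the_inv_into[OF bij] unfolding bijective_tableau_def sh(2) \<tau>_def
    by (simp add: bij_betw_restrict_eq)
  have box: "box_of sh \<tau> x = (r x, c x)" if "x \<in> {1..n}" for x
  proof -
    have "f x \<in> diagram sh" using that by (simp add: sh(2) D_def)
    from box_of_apply[OF bt this] show ?thesis using \<tau>f[OF that] by (simp add: f_def)
  qed
  have "schur_labeling n sh \<tau>"
    unfolding schur_labeling_def
  proof (intro conjI allI impI bt)
    fix i j j' assume *: "(i, j) \<in> diagram sh \<and> (i, j') \<in> diagram sh \<and> j < j'"
    then obtain x y where xy: "x \<in> {1..n}" "(i, j) = f x" "y \<in> {1..n}" "(i, j') = f y"
      unfolding sh(2) D_def by blast
    then have "y < x" using row_decreasing[of x y] * by (auto simp: f_def)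
    then show "\<tau> (i, j') < \<tau> (i, j)" unfolding xy(2,4) using \<tau>f xy by simp
  next
    fix i i' j assume *: "(i, j) \<in> diagram sh \<and> (i', j) \<in> diagram sh \<and> i < i'"
    then obtain x y where xy: "x \<in> {1..n}" "(i, j) = f x" "y \<in> {1..n}" "(i', j) = f y"
      unfolding sh(2) D_def by blast
    then have "x < y" using column_increasing[of x y] * by (auto simp: f_def)
    then show "\<tau> (i, j) < \<tau> (i', j)" unfolding xy(2,4) using \<tau>f xy by simp
  qed
  moreover have "tableau_poset n sh \<tau> = P"
    unfolding tableau_poset_def using poset_iff box by auto
  ultimately show thesis using that sh(1) box by blast
qed

text \<open>
  A Schur labeling that realises the poset need not list its components in the canonical order; the
  rearranged coordinates do.
\<close>

theorem canonical_labeling_exists: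
  assumes "P \<in> SP n"
  shows "\<exists>sh \<tau>. is_canonical_labeling n P sh \<tau>"
proof -
  obtain sh\<^sub>0 \<tau>\<^sub>0 where sh\<^sub>0: "is_basic_skew sh\<^sub>0" "schur_labeling n sh\<^sub>0 \<tau>\<^sub>0"
    and P: "P = tableau_poset n sh\<^sub>0 \<tau>\<^sub>0"
    using assms unfolding SP_def by blast
  interpret schur_coordinates n "label_row sh\<^sub>0 \<tau>\<^sub>0" "label_col sh\<^sub>0 \<tau>\<^sub>0" P
    unfolding P by (rule schur_coordinates_of_labeling[OF sh\<^sub>0])
  obtain sh \<tau> where *: "is_basic_skew sh" "schur_labeling n sh \<tau>" "tableau_poset n sh \<tau> = P"
    "\<And>x. x \<in> {1..n} \<Longrightarrow> box_of sh \<tau> x = (new_row x, new_col x)"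
    using schur_labeling_of_coordinates[OF schur_coordinates_new] by metis
  have "canonical_coordinates n (label_row sh \<tau>) P"
    using canonical_coordinates_new unfolding canonical_coordinates_def by (simp add: *(4))
  then have "is_canonical_labeling n P sh \<tau>"
    unfolding is_canonical_labeling_iff using *(1-3) by simp
  then show ?thesis by blast
qed

theorem canonical_labeling_unique:
  assumes can: "is_canonical_labeling n P sh \<tau>" and can': "is_canonical_labeling n P sh' \<tau>'"
  shows "sh = sh' \<and> \<tau> = \<tau>'"
proof -
  have A: "is_basic_skew sh" "schur_labeling n sh \<tau>" "tableau_poset n sh \<tau> = P"
      "canonical_coordinates n (label_row sh \<tau>) P"
    and B: "is_basic_skew sh'" "schur_labeling n sh' \<tau>'" "tableau_poset n sh' \<tau>' = P"
      "canonical_coordinates n (label_row sh' \<tau>') P"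
    using can can' unfolding is_canonical_labeling_iff by blast+
  have bt: "bijective_tableau n sh \<tau>" and bt': "bijective_tableau n sh' \<tau>'"
    using A(2) B(2) by (simp_all add: schur_labeling_def)
  interpret two_schur_coordinates n "label_row sh \<tau>" "label_col sh \<tau>"
    "label_row sh' \<tau>'" "label_col sh' \<tau>'" P
    unfolding two_schur_coordinates_def
    using schur_coordinates_of_labeling[OF A(1,2), unfolded A(3)]
      schur_coordinates_of_labeling[OF B(1,2), unfolded B(3)] by (rule conjI)
  have box: "box_of sh \<tau> x = box_of sh' \<tau>' x" if "x \<in> {1..n}" for x
    using canonical_coordinates_unique[OF A(4) B(4) that] by (simp add: prod_eq_iff)
  have dia: "diagram sh = diagram sh'"
  proof -
    have "box_of sh \<tau> ` {1..n} = box_of sh' \<tau>' ` {1..n}" by (rule image_cong[OF refl box])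
    then show ?thesis
      unfolding bij_betw_imp_surj_on[OF bij_betw_box_of[OF bt]]
        bij_betw_imp_surj_on[OF bij_betw_box_of[OF bt']] .
  qed
  have "\<tau> b = \<tau>' b" for b
  proof (cases "b \<in> diagram sh")
    case True
    let ?x = "\<tau>' b"
    have x: "?x \<in> {1..n}" using label_in[OF bt'] True dia by simp
    have "b = box_of sh \<tau> ?x" using box[OF x] box_of_apply[OF bt'] True dia by simp
    then show ?thesis using apply_box_of[OF bt x] by simp
  next
    case False
    then show ?thesis using bt bt' dia unfolding bijective_tableau_def
      by (metis extensional_arb)
  qed
  then show ?thesis using basic_skew_shape_eqI[OF A(1) B(1) dia] by blast
qed

text \<open>
  \<open>canonical_labeling\<close> is a definite description, so nothing is known about it before existence and
  uniqueness are established.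
\<close>

lemma is_canonical_labeling_canonical_labeling:
  assumes P: "P \<in> SP n" and eq: "(sh, \<tau>) = canonical_labeling n P"
  shows "is_canonical_labeling n P sh \<tau>"
proof -
  have "\<exists>!p. case p of (sh, \<tau>) \<Rightarrow> is_canonical_labeling n P sh \<tau>"
  proof (rule ex_ex1I)
    show "\<exists>p. case p of (sh, \<tau>) \<Rightarrow> is_canonical_labeling n P sh \<tau>"
      using canonical_labeling_exists[OF P] by simp
    fix p q assume "case p of (sh, \<tau>) \<Rightarrow> is_canonical_labeling n P sh \<tau>"
      "case q of (sh, \<tau>) \<Rightarrow> is_canonical_labeling n P sh \<tau>"
    then show "p = q"
      using canonical_labeling_unique[of n P "fst p" "snd p" "fst q" "snd q"]
      by (simp add: case_prod_unfold prod_eq_iff)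
  qed
  from theI'[OF this] show ?thesis unfolding canonical_labeling_def[symmetric] eq[symmetric] by simp
qed

section \<open>Row and column reading words\<close>

lemma row_tableau_eq_rank: "b \<in> diagram sh \<Longrightarrow> row_tableau sh b = rank (diagram sh) b"
  unfolding row_tableau_def rank_def
  by (cases b) (auto intro!: arg_cong[where f = card])

text \<open>
  Swapping the coordinates turns reading by columns into the lexicographic order.
\<close>

lemma col_tableau_eq_rank:
  assumes "b \<in> diagram sh"
  shows "col_tableau sh b = rank (prod.swap ` diagram sh) (prod.swap b)"
proof -
  obtain i j where b: "b = (i, j)" by (cases b)
  let ?S = "{(i', j'). (i', j') \<in> diagram sh \<and> (j' < j \<or> j' = j \<and> i' \<le> i)}"
  have "prod.swap ` ?S = {c \<in> prod.swap ` diagram sh. c \<le> prod.swap b}"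
    by (auto simp: b)
  moreover have "card (prod.swap ` ?S) = card ?S" by (rule card_image) simp
  ultimately show ?thesis using assms unfolding col_tableau_def rank_def b by simp
qed

lemma
  assumes bt: "bijective_tableau n sh \<tau>"
  shows read_row_permutes: "read_tableau n sh \<tau> (row_tableau sh) permutes {1..n}"
    and read_row_less_iff: "\<And>x y. x \<in> {1..n} \<Longrightarrow> y \<in> {1..n} \<Longrightarrow>
      read_tableau n sh \<tau> (row_tableau sh) x < read_tableau n sh \<tau> (row_tableau sh) y \<longleftrightarrow>
      label_row sh \<tau> x < label_row sh \<tau> y \<or>
      label_row sh \<tau> x = label_row sh \<tau> y \<and> label_col sh \<tau> x < label_col sh \<tau> y"
    and read_col_permutes: "read_tableau n sh \<tau> (col_tableau sh) permutes {1..n}"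
    and read_col_less_iff: "\<And>x y. x \<in> {1..n} \<Longrightarrow> y \<in> {1..n} \<Longrightarrow>
      read_tableau n sh \<tau> (col_tableau sh) x < read_tableau n sh \<tau> (col_tableau sh) y \<longleftrightarrow>
      label_col sh \<tau> x < label_col sh \<tau> y \<or>
      label_col sh \<tau> x = label_col sh \<tau> y \<and> label_row sh \<tau> x < label_row sh \<tau> y"
proof -
  let ?D = "diagram sh" and ?box = "box_of sh \<tau>"
  have bij: "bij_betw ?box {1..n} ?D" using bij_betw_box_of[OF bt] .
  then have fin: "finite ?D" and card: "card ?D = n"
    using bij_betw_finite bij_betw_same_card by fastforce+
  have sw: "bij_betw prod.swap ?D (prod.swap ` ?D)" by (simp add: bij_betw_def)
  have card': "card (prod.swap ` ?D) = n" using card by (simp add: card_image)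
  let ?R = "read_tableau n sh \<tau> (row_tableau sh)" and ?C = "read_tableau n sh \<tau> (col_tableau sh)"
  have R: "?R x = rank ?D (?box x)" if "x \<in> {1..n}" for x
    using that box_of_in[OF bt that] by (simp add: read_tableau_def row_tableau_eq_rank)
  have C: "?C x = rank (prod.swap ` ?D) (prod.swap (?box x))" if "x \<in> {1..n}" for x
    using that box_of_in[OF bt that] by (simp add: read_tableau_def col_tableau_eq_rank)
  have "bij_betw (rank ?D \<circ> ?box) {1..n} {1..n}"
    using bij_betw_trans[OF bij bij_betw_rank[OF fin]] unfolding card .
  then have "bij_betw ?R {1..n} {1..n}" by (rule bij_betw_cong[THEN iffD1, rotated]) (simp add: R)
  then show "?R permutes {1..n}" by (rule bij_imp_permutes) (auto simp: read_tableau_def)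
  have "bij_betw (rank (prod.swap ` ?D) \<circ> (prod.swap \<circ> ?box)) {1..n} {1..n}"
    using bij_betw_trans[OF bij_betw_trans[OF bij sw] bij_betw_rank[OF finite_imageI[OF fin]]]
    unfolding card' .
  then have "bij_betw ?C {1..n} {1..n}" by (rule bij_betw_cong[THEN iffD1, rotated]) (simp add: C)
  then show "?C permutes {1..n}" by (rule bij_imp_permutes) (auto simp: read_tableau_def)
  fix x y assume x: "x \<in> {1..n}" and y: "y \<in> {1..n}"
  note D = box_of_in[OF bt x] box_of_in[OF bt y]
  show "?R x < ?R y \<longleftrightarrow> label_row sh \<tau> x < label_row sh \<tau> y \<or>
      label_row sh \<tau> x = label_row sh \<tau> y \<and> label_col sh \<tau> x < label_col sh \<tau> y"
    unfolding R[OF x] R[OF y] rank_less_iff[OF fin D] less_prod_def by auto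
  show "?C x < ?C y \<longleftrightarrow> label_col sh \<tau> x < label_col sh \<tau> y \<or>
      label_col sh \<tau> x = label_col sh \<tau> y \<and> label_row sh \<tau> x < label_row sh \<tau> y"
    unfolding C[OF x] C[OF y]
      rank_less_iff[OF finite_imageI[OF fin] imageI[OF D(1)] imageI[OF D(2)]] less_prod_def
    by auto
qed

section \<open>Linear extensions form an interval\<close>

theorem theorem3p9:
  fixes n :: nat and P :: "(nat \<times> nat) set"
    and sh :: skew_shape and \<tau> :: "box \<Rightarrow> nat"
  assumes "P \<in> RSP n"
    and "(sh, \<tau>) = canonical_labeling n P"
  shows "Sigma_L n P =
    left_weak_interval n
      (read_tableau n sh \<tau> (row_tableau sh))
      (read_tableau n sh \<tau> (col_tableau sh))"
proof -
  have reg: "regular_poset n P" and "P \<in> SP n" using assms(1) by (simp_all add: RSP_def)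
  then have can: "is_basic_skew sh" "schur_labeling n sh \<tau>" "tableau_poset n sh \<tau> = P"
    "canonical_coordinates n (label_row sh \<tau>) P"
    using is_canonical_labeling_canonical_labeling[OF _ assms(2)]
    unfolding is_canonical_labeling_iff by blast+
  have bt: "bijective_tableau n sh \<tau>" using can(2) by (simp add: schur_labeling_def)
  interpret schur_coordinates n "label_row sh \<tau>" "label_col sh \<tau>" P
    using schur_coordinates_of_labeling[OF can(1,2)] unfolding can(3) .
  let ?r = "label_row sh \<tau>" and ?c = "label_col sh \<tau>"
  let ?R = "read_tableau n sh \<tau> (row_tableau sh)" and ?C = "read_tableau n sh \<tau> (col_tableau sh)"
  note R = read_row_permutes[OF bt] and C = read_col_permutes[OF bt]
  have inv_R: "(x, y) \<in> inversions n ?R \<longleftrightarrow>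
      x \<in> {1..n} \<and> y \<in> {1..n} \<and> x < y \<and> (?r y < ?r x \<or> ?r y = ?r x \<and> ?c y < ?c x)" for x y
    using read_row_less_iff[OF bt, of y x] by (auto simp: inversions_def)
  have inv_C: "(x, y) \<in> inversions n ?C \<longleftrightarrow>
      x \<in> {1..n} \<and> y \<in> {1..n} \<and> x < y \<and> (?c y < ?c x \<or> ?c y = ?c x \<and> ?r y < ?r x)" for x y
    using read_col_less_iff[OF bt, of y x] by (auto simp: inversions_def)
  have "(\<forall>(x, y)\<in>P. \<gamma> x \<le> \<gamma> y) \<longleftrightarrow>
      inversions n ?R \<subseteq> inversions n \<gamma> \<and> inversions n \<gamma> \<subseteq> inversions n ?C"
    if \<gamma>: "\<gamma> permutes {1..n}" for \<gamma>
  proof (intro iffI conjI subrelI)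
    have ne: "\<gamma> x \<noteq> \<gamma> y" if "x \<noteq> y" for x y
      using permutes_inj[OF \<gamma>] that by (auto dest: injD)
    assume ext: "\<forall>(x, y)\<in>P. \<gamma> x \<le> \<gamma> y"
    show "(x, y) \<in> inversions n \<gamma>" if "(x, y) \<in> inversions n ?R" for x y
    proof -
      from that have xy: "x \<in> {1..n}" "y \<in> {1..n}" "x < y"
        "?r y < ?r x \<or> ?r y = ?r x \<and> ?c y < ?c x" unfolding inv_R by auto
      \<comment> \<open>otherwise the larger label \<open>y\<close> is to the north-east of the smaller label \<open>x\<close>\<close>
      have "?c y \<le> ?c x"
      proof (rule ccontr)
        assume "\<not> ?c y \<le> ?c x"
        then have "?r y < ?r x" "?c x < ?c y" using xy(4) by auto
        then have "y < x" using north_east_less[OF reg can(4) xy(2,1)] by blast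
        with xy(3) show False by simp
      qed
      then have "(y, x) \<in> P" using xy by (auto simp: poset_iff)
      then have "\<gamma> y \<le> \<gamma> x" using ext by blast
      then show ?thesis using ne[of y x] xy by (auto simp: inversions_def)
    qed
    show "(x, y) \<in> inversions n ?C" if "(x, y) \<in> inversions n \<gamma>" for x y
    proof -
      from that have xy: "x \<in> {1..n}" "y \<in> {1..n}" "x < y" "\<gamma> y < \<gamma> x"
        by (auto simp: inversions_def)
      have "(x, y) \<notin> P" using ext xy(4) by force
      then have "\<not> (?r x \<le> ?r y \<and> ?c x \<le> ?c y)" using xy by (simp add: poset_iff)
      moreover have "\<not> (?r y < ?r x \<and> ?c x < ?c y)"
        using north_east_less[OF reg can(4) xy(2,1)] xy(3) by auto
      moreover have "\<not> (?c y = ?c x \<and> ?r y < ?r x)"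
        using column_increasing[OF xy(2,1)] xy(3) by auto
      ultimately have "?c y < ?c x" by linarith
      then show ?thesis using xy unfolding inv_C by blast
    qed
  next
    assume sub: "inversions n ?R \<subseteq> inversions n \<gamma> \<and> inversions n \<gamma> \<subseteq> inversions n ?C"
    have "\<gamma> x \<le> \<gamma> y" if xy: "(x, y) \<in> P" for x y
    proof (cases x y rule: linorder_cases)
      case less
      have "(x, y) \<notin> inversions n ?C" using xy unfolding inv_C by (auto simp: poset_iff)
      then have "(x, y) \<notin> inversions n \<gamma>" using sub by blast
      then show ?thesis using less xy by (auto simp: inversions_def poset_iff)
    next
      case greater
      have "\<not> (?r x = ?r y \<and> ?c x = ?c y)"
        using coordinates_inj[of x y] xy greater by (auto simp: poset_iff)
      then have "(y, x) \<in> inversions n ?R"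
        using xy greater unfolding inv_R by (auto simp: poset_iff)
      then have "(y, x) \<in> inversions n \<gamma>" using sub by blast
      then show ?thesis by (auto simp: inversions_def)
    qed simp
    then show "\<forall>(x, y)\<in>P. \<gamma> x \<le> \<gamma> y" by blast
  qed
  then show ?thesis
    unfolding Sigma_L_def left_weak_interval_def
    using left_weak_le_iff_inversions[OF R] left_weak_le_iff_inversions[OF _ C] by blast
qed

end
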